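(* Let $\mathcal{A}$ be an open set of $\mathbb{R}^4$ and $h:\mathcal{A}\to\mathbb{R}$ a smooth function. Let $I\in\mathcal{A}$ be a point such that $\nabla h(I)\neq 0$. Suppose that: 1. $h$ is five-jet non-degenerate at $I$, i.e. the only $v\in\mathbb{R}^4$ with $h^1_I[v]=0$, $h^2_I[v,v]=0$, $h^3_I[v,v,v]=0$, $h^4_I[v,v,v,v]=0$, $h^5_I[v,v,v,v,v]=0$ is $v=0$; 2. for every $v\in\mathbb{R}^4$, $v\neq 0$, such that $h^1_I[v]=h^2_I[v,v]=h^3_I[v,v,v]=0$, any vector $u\in\mathbb{R}^4$ solving the system $$\begin{cases} h^1_I[u]=0,\quad h^2_I[u,v]=0,\quad h^2_I[u,u]\,h^4_I[v,v,v,v]=3(h^3_I[v,v,u])^2,\\ 15(h_I^3[v,v,u])^2h_I^3[u,u,v]+h_I^5[v,v,v,v,v](h_I^2[u,u])^2=10\,h_I^4[v,v,v,u]\,h_I^3[u,v,v]\,h_I^2[u,u] \end{cases}$$ satisfies $\mathrm{rk}(u,v)<2$; 3. for every $v\in\mathbb{R}^4$, $v\neq 0$, such that $h^1_I[v]=h^2_I[v,v]=h^3_I[v,v,v]=0$, any couple of vectors $(u,w)$ in $\mathbb{R}^4$ solving $$h_I^1[u]=0,\quad h_I^1[w]=0,\quad h_I^2[u,v]=0,\quad h_I^2[w,v]=0$$ satisfies $\mathrm{rk}(u,v,w)<3$. Then $h$ is steep in some neighborhood of $I$.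
   Context: Notation: for a smooth function $h$ of $n$ variables, $h_I^k[v^1,\dots,v^k]=\sum_{i_1,\dots,i_k=1}^n \frac{\partial^k h}{\partial I_{i_1}\cdots\partial I_{i_k}}(I)\,v^1_{i_1}\cdots v^k_{i_k}$ for $v^1,\dots,v^k\in\mathbb{R}^n$. $\mathrm{rk}(v_1,\dots,v_m)$ is the rank of the matrix with columns $v_1,\dots,v_m$. Steepness at a point: let $\mathcal{A}\subset\mathbb{R}^n$ be open and $h:\mathcal{A}\to\mathbb{R}$ smooth. $h$ is steep at $I\in\mathcal{A}$ if $\nabla h(I)\neq 0$ and if, for every $m=1,\dots,n-1$, there exist constants $C_m>0$, $\delta_m>0$, $\alpha_m>1$ such that, for all $m$-dimensional affine subspaces $\Lambda_m^I$ through $I$ orthogonal to $\nabla h(I)$, the gradient $\nabla(h|_{\Lambda_m^I})$ of the restriction of $h$ to $\Lambda_m^I$ satisfies $$\max_{0\le\eta\le\xi}\Big(\min_{I'\in\Lambda_m^I,\ \|I-I'\|=\eta}\|\nabla(h|_{\Lambda_m^I})(I')\|\Big)>C_m\xi^{\alpha_m}\qquad\forall\,\xi\in(0,\delta_m].$$ The $C_m,\delta_m$ are called steepness coefficients and the $\alpha_m$ steepness indices. $h$ is steep in a given domain if it is steep at each point of that domain with uniform indices and coefficients (the same $C_m,\delta_m,\alpha_m$ at all points). *)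

theory Defs
  imports "HOL-Analysis.Analysis"
begin

definition partial_deriv :: "'n::finite \<Rightarrow> (real^'n \<Rightarrow> real) \<Rightarrow> real^'n \<Rightarrow> real" where
  "partial_deriv i f x = deriv (\<lambda>t. f (x + t *\<^sub>R axis i 1)) 0"

primrec iter_partial :: "'n::finite list \<Rightarrow> (real^'n \<Rightarrow> real) \<Rightarrow> real^'n \<Rightarrow> real" where
  "iter_partial [] f = f"
| "iter_partial (i # is) f = partial_deriv i (iter_partial is f)"

(* Meant for open A.  There, requiring every iterated partial derivative to be
   differentiable amounts to membership in C^infinity(A). *)
definition smooth_fun_on :: "(real^'n::finite) set \<Rightarrow> (real^'n \<Rightarrow> real) \<Rightarrow> bool" where
  "smooth_fun_on A h \<longleftrightarrow> (\<forall>is. iter_partial is h differentiable_on A)"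

(* jet_form h I [v1, ..., vk] is the k-linear form h_I^k[v1, ..., vk]; the list "is"
   runs over all multi-indices (i_1, ..., i_k). *)
definition jet_form :: "(real^'n::finite \<Rightarrow> real) \<Rightarrow> real^'n \<Rightarrow> (real^'n) list \<Rightarrow> real" where
  "jet_form h I vs =
    (\<Sum>is\<in>{is. length is = length vs}.
      iter_partial is h I * (\<Prod>j<length vs. (vs ! j) $ (is ! j)))"

definition grad :: "(real^'n::finite \<Rightarrow> real) \<Rightarrow> real^'n \<Rightarrow> real^'n" where
  "grad h x = (\<chi> i. partial_deriv i h x)"

(* Gradient at x of the restriction of h to the affine subspace L: the vector of the
   direction space of L that represents the derivative of h along L. *)
definition restr_grad :: "(real^'n::finite \<Rightarrow> real) \<Rightarrow> (real^'n) set \<Rightarrow> real^'n \<Rightarrow> real^'n" where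
  "restr_grad h L x =
    (THE g. g \<in> (\<lambda>y. y - x) ` L \<and> (h has_derivative (\<lambda>v. g \<bullet> v)) (at x within L))"

definition five_jet_nondegenerate :: "(real^'n::finite \<Rightarrow> real) \<Rightarrow> real^'n \<Rightarrow> bool" where
  "five_jet_nondegenerate h I \<longleftrightarrow>
    (\<forall>v. jet_form h I [v] = 0 \<and> jet_form h I [v, v] = 0 \<and> jet_form h I [v, v, v] = 0 \<and>
         jet_form h I [v, v, v, v] = 0 \<and> jet_form h I [v, v, v, v, v] = 0 \<longrightarrow> v = 0)"

(* The m-dimensional affine subspaces through I orthogonal to the gradient of h at I. *)
definition orth_affine_subspaces ::
    "(real^'n::finite \<Rightarrow> real) \<Rightarrow> nat \<Rightarrow> real^'n \<Rightarrow> (real^'n) set set" where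
  "orth_affine_subspaces h m I =
    {L. affine L \<and> I \<in> L \<and> aff_dim L = int m \<and> (\<forall>y\<in>L. (y - I) \<bullet> grad h I = 0)}"

(* The steepness inequality at I in dimension m.  As h is only given on A, the inequality
   presupposes that the spheres of radius at most \<delta> in L about I lie in A; this is the
   inclusion below.  For m \<ge> 1 and h smooth on the open set A, the infima and the supremum
   are then attained (continuous functions on nonempty compact sets), so they are the
   minima and the maximum of the usual definition. *)
definition steep_ineq ::
    "(real^'n::finite) set \<Rightarrow> (real^'n \<Rightarrow> real) \<Rightarrow> nat \<Rightarrow> real \<Rightarrow> real \<Rightarrow> real \<Rightarrow> real^'n \<Rightarrow> bool" where
  "steep_ineq A h m C \<delta> \<alpha> I \<longleftrightarrow>
    (\<forall>L\<in>orth_affine_subspaces h m I.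
      L \<inter> cball I \<delta> \<subseteq> A \<and>
      (\<forall>\<xi>\<in>{0<..\<delta>}.
        (SUP \<eta>\<in>{0..\<xi>}. INF J\<in>L \<inter> sphere I \<eta>. norm (restr_grad h L J)) > C * \<xi> powr \<alpha>))"

(* Steepness in a domain D: steepness at each point of D, with coefficients and indices
   not depending on the point.  D = {I} gives steepness at the point I. *)
definition steep_on :: "(real^'n::finite) set \<Rightarrow> (real^'n \<Rightarrow> real) \<Rightarrow> (real^'n) set \<Rightarrow> bool" where
  "steep_on A h D \<longleftrightarrow>
    D \<subseteq> A \<and> (\<forall>I\<in>D. grad h I \<noteq> 0) \<and>
    (\<forall>m\<in>{1..CARD('n) - 1}. \<exists>C \<delta> \<alpha>. C > 0 \<and> \<delta> > 0 \<and> \<alpha> > 1 \<and>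
      (\<forall>I\<in>D. steep_ineq A h m C \<delta> \<alpha> I))"

end

theory Submission
  imports Defs
begin

text \<open>
  If the inequality with index \<open>4\<close> failed in dimension \<open>m\<close> on every neighbourhood of \<open>I\<close>, there would be
  points \<open>X\<^sub>n \<rightarrow> I\<close>, \<open>m\<close>-dimensional subspaces \<open>V\<^sub>n\<close> orthogonal to the gradient at \<open>X\<^sub>n\<close>, and scales
  \<open>\<xi>\<^sub>n \<rightarrow> 0\<close> such that every sphere of radius \<open>r \<xi>\<^sub>n\<close>, \<open>0 \<le> r \<le> 1\<close>, in \<open>X\<^sub>n + V\<^sub>n\<close> carries a point
  \<open>X\<^sub>n + \<xi>\<^sub>n q\<^sub>n(r)\<close> at which the restricted gradient is \<open>o(\<xi>\<^sub>n\<^sup>4)\<close>.  All limits are taken along one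
  ultrafilter, so that bounded sequences converge and no subsequences are needed.  By Taylor's formula
  \<open>h\<^sup>2[q,w] + \<xi> h\<^sup>3[q,q,w] / 2 + \<xi>\<^sup>2 h\<^sup>4[q,q,q,w] / 6 + \<xi>\<^sup>3 h\<^sup>5[q,q,q,q,w] / 24 = o(\<xi>\<^sup>3)\<close> for \<open>w \<in> V\<^sub>n\<close>.

  On a line this is a polynomial of degree four that is small at points of every modulus up to \<open>1\<close>, so
  all its coefficients are small, and the limit direction violates five-jet nondegeneracy.

  On the hyperplane the limits of \<open>q\<^sub>n(r)\<close> lie in the kernel of \<open>h\<^sup>2\<close>.  If those for \<open>r = 1\<close> and
  \<open>r = 1/2\<close> are independent, the odd form \<open>h\<^sup>3[v,v,v]\<close> vanishes somewhere on their span; if they are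
  dependent, the symmetry of \<open>h\<^sup>2\<close> gives \<open>h\<^sup>3[q,q,p] = h\<^sup>3[p,p,q]\<close>, hence \<open>h\<^sup>3[q,q,q] = 0\<close>.
  Either way hypothesis 3 fails.

  On a plane choose orthonormal \<open>u, v\<close> diagonalising \<open>h\<^sup>2\<close>, with \<open>a = h\<^sup>2[u,u]\<close> the larger entry.  If
  \<open>a / \<xi>\<close> is unbounded, eliminating the \<open>u\<close>-coordinate leaves a quartic polynomial whose coefficients
  are, in the limit, exactly the expressions in hypothesis 2.  If it is bounded, rescaling yields
  a polynomial that is the sum of a quadratic and a cubic form and has a critical point on every
  circle of radius at most \<open>1\<close>; by hypothesis 2 its cubic part is nondegenerate, so it has only finitely
  many critical points.
\<close>

subsection \<open>Jets as symmetric multilinear forms\<close>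

lemma has_derivative_partial_deriv:
  fixes f :: "real^'n::finite \<Rightarrow> real"
  assumes "f differentiable at x"
  shows "(f has_derivative (\<lambda>p. \<Sum>i\<in>UNIV. p $ i * partial_deriv i f x)) (at x)"
proof -
  obtain f' where f': "(f has_derivative f') (at x)"
    using assms unfolding differentiable_def by blast
  interpret bounded_linear f' using f' by (rule has_derivative_bounded_linear)
  have pd: "partial_deriv i f x = f' (axis i 1)" for i
  proof -
    have "((\<lambda>t. f (x + t *\<^sub>R axis i 1)) has_derivative (\<lambda>t. f' (t *\<^sub>R axis i 1))) (at 0)"
      by (rule has_derivative_compose[where g = f and f = "\<lambda>t. x + t *\<^sub>R axis i 1"])
        (auto intro!: derivative_eq_intros f')
    then have "((\<lambda>t. f (x + t *\<^sub>R axis i 1)) has_field_derivative f' (axis i 1)) (at 0)"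
      unfolding has_field_derivative_def scaleR real_scaleR_def
      by (simp only: mult.commute[of _ "f' (axis i 1)"])
    then show ?thesis unfolding partial_deriv_def by (rule DERIV_imp_deriv)
  qed
  have "f' p = (\<Sum>i\<in>UNIV. p $ i * partial_deriv i f x)" for p
  proof -
    have "f' p = f' (\<Sum>i\<in>UNIV. p $ i *\<^sub>R axis i 1)"
      using basis_expansion[of p] unfolding scalar_mult_eq_scaleR by simp
    then show ?thesis by (simp add: sum scaleR pd)
  qed
  then have "f' = (\<lambda>p. \<Sum>i\<in>UNIV. p $ i * partial_deriv i f x)" by (rule ext)
  then show ?thesis using f' by simp
qed

lemma DERIV_along_line:
  fixes f :: "real^'n::finite \<Rightarrow> real"
  assumes "f differentiable at (x + t *\<^sub>R p)"
  shows "((\<lambda>t. f (x + t *\<^sub>R p)) has_field_derivative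
    (\<Sum>i\<in>UNIV. p $ i * partial_deriv i f (x + t *\<^sub>R p))) (at t)"
proof -
  have "((\<lambda>t. f (x + t *\<^sub>R p)) has_derivative
     (\<lambda>s. \<Sum>i\<in>UNIV. (s *\<^sub>R p) $ i * partial_deriv i f (x + t *\<^sub>R p))) (at t)"
    by (rule has_derivative_compose[where g = f and f = "\<lambda>t. x + t *\<^sub>R p",
          OF _ has_derivative_partial_deriv[OF assms]])
      (auto intro!: derivative_eq_intros)
  moreover have "(\<lambda>s. \<Sum>i\<in>UNIV. (s *\<^sub>R p) $ i * partial_deriv i f (x + t *\<^sub>R p))
      = (*) (\<Sum>i\<in>UNIV. p $ i * partial_deriv i f (x + t *\<^sub>R p))"
    by (rule ext) (simp only: sum_distrib_right sum_distrib_left vector_scaleR_component real_scaleR_def mult_ac)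
  ultimately show ?thesis by (simp add: has_field_derivative_def)
qed

lemma DERIV_along_axis:
  fixes f :: "real^'n::finite \<Rightarrow> real"
  assumes "f differentiable at (x + t *\<^sub>R axis i 1)"
  shows "((\<lambda>t. f (x + t *\<^sub>R axis i 1)) has_field_derivative
    partial_deriv i f (x + t *\<^sub>R axis i 1)) (at t)"
proof -
  have "(\<Sum>j\<in>UNIV. axis i 1 $ j * partial_deriv j f y) = partial_deriv i f y" for y
    by (simp add: axis_def if_distrib[where f = "\<lambda>a. a * _"] cong: if_cong)
  then show ?thesis using DERIV_along_line[OF assms] by simp
qed

text \<open>Two uses of the mean value theorem: along axis \<open>i\<close> for the increment in
  direction \<open>j\<close>, then along axis \<open>j\<close> for the partial derivative so
  obtained. The left side is symmetric in \<open>i\<close> and \<open>j\<close>, whereas the right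
  side records an order of differentiation.\<close>

lemma second_difference_eq:
  fixes f :: "real^'n::finite \<Rightarrow> real"
  assumes "cball x (2 * t) \<subseteq> A" "0 < t"
    and "\<And>y. y \<in> A \<Longrightarrow> f differentiable at y"
    and "\<And>y. y \<in> A \<Longrightarrow> partial_deriv i f differentiable at y"
  shows "\<exists>y\<in>cball x (2 * t).
    f (x + t *\<^sub>R axis i 1 + t *\<^sub>R axis j 1) - f (x + t *\<^sub>R axis i 1) - f (x + t *\<^sub>R axis j 1) + f x
      = t\<^sup>2 * partial_deriv j (partial_deriv i f) y"
proof -
  let ?e = "axis i 1 :: real^'n" and ?d = "axis j 1 :: real^'n"
  have mem: "x + s *\<^sub>R ?e + r *\<^sub>R ?d \<in> cball x (2 * t)" if "0 \<le> s" "s \<le> t" "0 \<le> r" "r \<le> t" for s r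
  proof -
    have "norm (s *\<^sub>R ?e + r *\<^sub>R ?d) \<le> s + r"
      using norm_triangle_ineq[of "s *\<^sub>R ?e" "r *\<^sub>R ?d"] that by simp
    then show ?thesis using that norm_minus_commute[of x "x + s *\<^sub>R ?e + r *\<^sub>R ?d"]
      by (simp add: dist_norm add.assoc)
  qed
  then have memA: "x + s *\<^sub>R ?e + r *\<^sub>R ?d \<in> A" if "0 \<le> s" "s \<le> t" "0 \<le> r" "r \<le> t" for s r
    using that assms(1) by blast
  define g where "g s = f (x + t *\<^sub>R ?d + s *\<^sub>R ?e) - f (x + s *\<^sub>R ?e)" for s
  have "DERIV g s :> partial_deriv i f (x + t *\<^sub>R ?d + s *\<^sub>R ?e) - partial_deriv i f (x + s *\<^sub>R ?e)"
    if "0 \<le> s" "s \<le> t" for s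
    unfolding g_def using memA[of s t] memA[of s 0] that assms(2)
    by (intro DERIV_diff DERIV_along_axis assms(3)) (auto simp: algebra_simps)
  from MVT2[OF assms(2) this] obtain s where s: "0 < s" "s < t" and
    gs: "g t - g 0 = t * (partial_deriv i f (x + t *\<^sub>R ?d + s *\<^sub>R ?e) - partial_deriv i f (x + s *\<^sub>R ?e))"
    by auto
  have "((\<lambda>r. partial_deriv i f (x + s *\<^sub>R ?e + r *\<^sub>R ?d)) has_field_derivative
      partial_deriv j (partial_deriv i f) (x + s *\<^sub>R ?e + r *\<^sub>R ?d)) (at r)"
    if "0 \<le> r" "r \<le> t" for r
    using memA[of s r] that s by (intro DERIV_along_axis assms(4)) auto
  from MVT2[OF assms(2) this] obtain r where r: "0 < r" "r < t" and
    gr: "partial_deriv i f (x + s *\<^sub>R ?e + t *\<^sub>R ?d) - partial_deriv i f (x + s *\<^sub>R ?e)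
      = t * partial_deriv j (partial_deriv i f) (x + s *\<^sub>R ?e + r *\<^sub>R ?d)"
    by auto
  show ?thesis
  proof (rule bexI)
    show "x + s *\<^sub>R ?e + r *\<^sub>R ?d \<in> cball x (2 * t)" using mem s r by auto
    have "g t - g 0 = t\<^sup>2 * partial_deriv j (partial_deriv i f) (x + s *\<^sub>R ?e + r *\<^sub>R ?d)"
      using gs gr by (simp add: power2_eq_square add.assoc add.commute[of "t *\<^sub>R ?d"])
    then show "f (x + t *\<^sub>R ?e + t *\<^sub>R ?d) - f (x + t *\<^sub>R ?e) - f (x + t *\<^sub>R ?d) + f x
      = t\<^sup>2 * partial_deriv j (partial_deriv i f) (x + s *\<^sub>R ?e + r *\<^sub>R ?d)"
      by (simp add: g_def algebra_simps)
  qed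
qed

text \<open>The symmetric second difference gives both mixed derivatives a common value, attained at
  two possibly different points near \<open>x\<close>. Continuity at \<open>x\<close> then forces
  equality there.\<close>

lemma partial_deriv_commute:
  fixes f :: "real^'n::finite \<Rightarrow> real"
  assumes "open A" "x \<in> A"
    and f: "\<And>y. y \<in> A \<Longrightarrow> f differentiable at y"
    and f1: "\<And>i y. y \<in> A \<Longrightarrow> partial_deriv i f differentiable at y"
    and f2: "\<And>i j. isCont (partial_deriv i (partial_deriv j f)) x"
  shows "partial_deriv i (partial_deriv j f) x = partial_deriv j (partial_deriv i f) x"
proof (rule ccontr)
  let ?P = "partial_deriv i (partial_deriv j f)" and ?Q = "partial_deriv j (partial_deriv i f)"
  assume ne: "?P x \<noteq> ?Q x"
  define \<epsilon> where "\<epsilon> = \<bar>?P x - ?Q x\<bar> / 2"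
  have "\<epsilon> > 0" using ne by (simp add: \<epsilon>_def)
  obtain d1 where d1: "d1 > 0" "\<And>y. dist y x < d1 \<Longrightarrow> dist (?P y) (?P x) < \<epsilon>"
    using f2[of i j] \<open>\<epsilon> > 0\<close> unfolding continuous_at_eps_delta by blast
  obtain d2 where d2: "d2 > 0" "\<And>y. dist y x < d2 \<Longrightarrow> dist (?Q y) (?Q x) < \<epsilon>"
    using f2[of j i] \<open>\<epsilon> > 0\<close> unfolding continuous_at_eps_delta by blast
  obtain d3 where d3: "d3 > 0" "cball x d3 \<subseteq> A"
    using assms(1,2) open_contains_cball by blast
  \<comment> \<open>The divisor 3 keeps \<open>2 * t\<close> strictly below both continuity radii
    and within the ball contained in \<open>A\<close>.\<close>
  define t where "t = min (min d1 d2) d3 / 3"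
  have t: "0 < t" "2 * t < d1" "2 * t < d2" "2 * t \<le> d3" using d1 d2 d3 by (auto simp: t_def)
  have sub: "cball x (2 * t) \<subseteq> A" using t d3 subset_cball[of "2 * t" d3 x] by auto
  obtain y where y: "y \<in> cball x (2 * t)"
    "f (x + t *\<^sub>R axis i 1 + t *\<^sub>R axis j 1) - f (x + t *\<^sub>R axis i 1) - f (x + t *\<^sub>R axis j 1) + f x
      = t\<^sup>2 * ?Q y"
    using second_difference_eq[OF sub t(1) f f1, of i j] by auto
  obtain z where z: "z \<in> cball x (2 * t)"
    "f (x + t *\<^sub>R axis j 1 + t *\<^sub>R axis i 1) - f (x + t *\<^sub>R axis j 1) - f (x + t *\<^sub>R axis i 1) + f x
      = t\<^sup>2 * ?P z"
    using second_difference_eq[OF sub t(1) f f1, of j i] by auto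
  have "t\<^sup>2 * ?P z = t\<^sup>2 * ?Q y" unfolding y(2)[symmetric] z(2)[symmetric]
    by (simp add: algebra_simps)
  then have "?P z = ?Q y" using t by simp
  moreover have "dist (?P z) (?P x) < \<epsilon>" "dist (?Q y) (?Q x) < \<epsilon>"
    using y(1) z(1) t d1(2)[of z] d2(2)[of y] by (auto simp: dist_commute)
  ultimately show False unfolding \<epsilon>_def dist_real_def by argo
qed

text \<open>Equality at a single point would not survive differentiation, but equality on an open
  set does. This lets a swap of two inner derivatives pass under any number of outer ones.\<close>

lemma partial_deriv_cong_open:
  fixes f g :: "real^'n::finite \<Rightarrow> real"
  assumes "open A" "x \<in> A" "\<And>y. y \<in> A \<Longrightarrow> f y = g y"
  shows "partial_deriv i f x = partial_deriv i g x"
  unfolding partial_deriv_def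
proof (rule deriv_cong_ev)
  have "((\<lambda>t. x + t *\<^sub>R axis i (1::real)) \<longlongrightarrow> x + 0 *\<^sub>R axis i 1) (nhds 0)"
    by (intro tendsto_intros filterlim_ident)
  then have "eventually (\<lambda>t. x + t *\<^sub>R axis i 1 \<in> A) (nhds 0)"
    by (rule topological_tendstoD) (use assms(1,2) in auto)
  then show "\<forall>\<^sub>F t in nhds 0. f (x + t *\<^sub>R axis i 1) = g (x + t *\<^sub>R axis i 1)"
    by eventually_elim (rule assms(3))
qed simp

text \<open>\<^const>\<open>jet_form\<close> by recursion on the arguments.  The coefficients are arbitrary, so that an
  induction on the arguments can absorb the first index into them.\<close>

primrec multi_form :: "('n::finite list \<Rightarrow> real) \<Rightarrow> (real^'n) list \<Rightarrow> real" where
  "multi_form c [] = c []"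
| "multi_form c (v # vs) = (\<Sum>i\<in>UNIV. v $ i * multi_form (\<lambda>is. c (i # is)) vs)"

lemma multi_form_eq_sum:
  "multi_form c vs = (\<Sum>is\<in>{is. length is = length vs}. c is * (\<Prod>j<length vs. (vs ! j) $ (is ! j)))"
proof (induction vs arbitrary: c)
  case Nil
  show ?case by simp
next
  case (Cons v vs)
  have "{is :: 'a list. length is = length (v # vs)} = (\<lambda>(i, is). i # is) ` (UNIV \<times> {is. length is = length vs})"
    by (auto simp: length_Suc_conv image_iff)
  then have "(\<Sum>is\<in>{is. length is = length (v # vs)}. c is * (\<Prod>j<length (v # vs). ((v # vs) ! j) $ (is ! j)))
    = (\<Sum>(i, is)\<in>UNIV \<times> {is. length is = length vs}.
        c (i # is) * (\<Prod>j<length (v # vs). ((v # vs) ! j) $ ((i # is) ! j)))"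
    by (simp add: sum.reindex inj_on_def case_prod_unfold del: prod.lessThan_Suc)
  also have "\<dots> = (\<Sum>i\<in>UNIV. \<Sum>is\<in>{is. length is = length vs}.
        v $ i * (c (i # is) * (\<Prod>j<length vs. (vs ! j) $ (is ! j))))"
    by (simp add: sum.cartesian_product prod.lessThan_Suc_shift mult_ac del: prod.lessThan_Suc)
  finally show ?case by (simp add: Cons.IH sum_distrib_left)
qed

lemma jet_form_eq_multi_form: "jet_form h x vs = multi_form (\<lambda>is. iter_partial is h x) vs"
  by (simp add: jet_form_def multi_form_eq_sum)

lemma multi_form_add:
  "multi_form c (vs @ (u + w) # ws) = multi_form c (vs @ u # ws) + multi_form c (vs @ w # ws)"
  by (induction vs arbitrary: c) (simp_all add: sum.distrib algebra_simps)

lemma multi_form_scaleR: "multi_form c (vs @ (a *\<^sub>R u) # ws) = a * multi_form c (vs @ u # ws)"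
  by (induction vs arbitrary: c) (simp_all add: sum_distrib_left algebra_simps)

text \<open>Symmetry is assumed behind every prefix of indices, so that it persists when the
  induction absorbs the first index into the coefficients.\<close>

lemma multi_form_swap:
  assumes "\<And>is i j js. c (is @ i # j # js) = c (is @ j # i # js)"
  shows "multi_form c (vs @ u # w # ws) = multi_form c (vs @ w # u # ws)"
  using assms
proof (induction vs arbitrary: c)
  case Nil
  have c: "c (i # j # js) = c (j # i # js)" for i j js using Nil[of "[]"] by simp
  have "multi_form c ([] @ u # w # ws)
    = (\<Sum>i\<in>UNIV. \<Sum>j\<in>UNIV. u $ i * (w $ j * multi_form (\<lambda>is. c (j # i # is)) ws))"
    by (simp add: sum_distrib_left c)
  also have "\<dots> = (\<Sum>j\<in>UNIV. \<Sum>i\<in>UNIV. u $ i * (w $ j * multi_form (\<lambda>is. c (j # i # is)) ws))"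
    by (rule sum.swap)
  finally show ?case by (simp add: sum_distrib_left mult_ac)
next
  case (Cons v vs)
  have "multi_form (\<lambda>is. c (i # is)) (vs @ u # w # ws) = multi_form (\<lambda>is. c (i # is)) (vs @ w # u # ws)" for i
    by (rule Cons.IH) (use Cons.prems[of "i # _"] in simp)
  then show ?case by simp
qed

text \<open>Coefficients and arguments vary together, because jets are later taken at moving base
  points and on moving vectors.\<close>

lemma multi_form_tendsto:
  assumes "\<And>is. ((\<lambda>n. c n is) \<longlongrightarrow> c' is) F" "list_all2 (\<lambda>f l. (f \<longlongrightarrow> l) F) fs ls"
  shows "((\<lambda>n. multi_form (c n) (map (\<lambda>f. f n) fs)) \<longlongrightarrow> multi_form c' ls) F"
  using assms(2,1)
proof (induction arbitrary: c c' rule: list_all2_induct)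
  case Nil
  then show ?case by simp
next
  case (Cons f fs l ls)
  have "((\<lambda>n. multi_form (\<lambda>is. c n (i # is)) (map (\<lambda>f. f n) fs))
      \<longlongrightarrow> multi_form (\<lambda>is. c' (i # is)) ls) F" for i
    by (rule Cons.IH) (rule Cons.prems)
  then show ?case
    using Cons.hyps(1) by (simp, intro tendsto_intros)
qed

text \<open>The arguments are constant and only the coefficients are differentiated. A derivative
  adds an index in front, hence the direction of differentiation becomes the first argument in
  \<open>jet_form_has_derivative\<close>.\<close>

lemma multi_form_has_derivative:
  assumes "\<And>is. ((\<lambda>x. c x is) has_derivative (\<lambda>p. \<Sum>i\<in>UNIV. p $ i * c' i is)) (at x)"
  shows "((\<lambda>x. multi_form (c x) vs) has_derivative (\<lambda>p. \<Sum>i\<in>UNIV. p $ i * multi_form (c' i) vs)) (at x)"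
  using assms
proof (induction vs arbitrary: c c')
  case Nil
  then show ?case by simp
next
  case (Cons v vs)
  have "((\<lambda>x. multi_form (\<lambda>is. c x (j # is)) vs) has_derivative
      (\<lambda>p. \<Sum>i\<in>UNIV. p $ i * multi_form (\<lambda>is. c' i (j # is)) vs)) (at x)" for j
    by (rule Cons.IH) (rule Cons.prems)
  then have "((\<lambda>x. multi_form (c x) (v # vs)) has_derivative
      (\<lambda>p. \<Sum>j\<in>UNIV. v $ j * (\<Sum>i\<in>UNIV. p $ i * multi_form (\<lambda>is. c' i (j # is)) vs))) (at x)"
    by (auto intro!: derivative_eq_intros)
  moreover have "(\<Sum>j\<in>UNIV. v $ j * (\<Sum>i\<in>UNIV. p $ i * multi_form (\<lambda>is. c' i (j # is)) vs))
    = (\<Sum>i\<in>UNIV. p $ i * multi_form (c' i) (v # vs))" for p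
    unfolding multi_form.simps sum_distrib_left by (subst sum.swap) (simp add: mult_ac)
  ultimately show ?case by simp
qed

section \<open>Jets of a smooth function: symmetry, continuity and Taylor's formula\<close>

locale smooth_on_open =
  fixes A :: "(real^'n::finite) set" and h :: "real^'n \<Rightarrow> real"
  assumes open_A: "open A" and smooth: "smooth_fun_on A h"
begin

lemma iter_partial_differentiable: "x \<in> A \<Longrightarrow> iter_partial is h differentiable at x"
  using smooth open_A unfolding smooth_fun_on_def
  by (metis differentiable_on_eq_differentiable_at)

lemma iter_partial_isCont: "x \<in> A \<Longrightarrow> isCont (iter_partial is h) x"
  by (simp add: differentiable_imp_continuous_within iter_partial_differentiable)

lemma iter_partial_swap:
  "x \<in> A \<Longrightarrow> iter_partial (is @ i # j # js) h x = iter_partial (is @ j # i # js) h x"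
proof (induction "is" arbitrary: x)
  case Nil
  show ?case unfolding append_Nil iter_partial.simps
  proof (rule partial_deriv_commute[OF open_A Nil])
    show "partial_deriv i (iter_partial js h) differentiable at y" if "y \<in> A" for i y
      using iter_partial_differentiable[OF that, of "i # js"] by simp
    show "isCont (partial_deriv i (partial_deriv j (iter_partial js h))) x" for i j
      using iter_partial_isCont[OF Nil, of "i # j # js"] by simp
  qed (rule iter_partial_differentiable)
next
  case (Cons k "is")
  show ?case unfolding append_Cons iter_partial.simps
    by (rule partial_deriv_cong_open[OF open_A Cons.prems Cons.IH])
qed

lemma jet_form_swap:
  "x \<in> A \<Longrightarrow> jet_form h x (vs @ u # w # ws) = jet_form h x (vs @ w # u # ws)"
  unfolding jet_form_eq_multi_form by (rule multi_form_swap) (rule iter_partial_swap)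

lemma jet_form_to_front:
  assumes "x \<in> A"
  shows "jet_form h x (us @ vs @ u # ws) = jet_form h x (us @ u # vs @ ws)"
proof (induction vs arbitrary: us)
  case (Cons v vs)
  have "jet_form h x (us @ (v # vs) @ u # ws) = jet_form h x ((us @ [v]) @ u # vs @ ws)"
    using Cons[of "us @ [v]"] by simp
  then show ?case using jet_form_swap[OF assms, of us v u "vs @ ws"] by simp
qed simp

text \<open>Adjacent transpositions generate all permutations. The prefix \<open>us\<close> of the
  inner claim collects the arguments already matched.\<close>

lemma jet_form_mset:
  assumes "x \<in> A" "mset vs = mset ws"
  shows "jet_form h x vs = jet_form h x ws"
proof -
  have "jet_form h x (us @ vs) = jet_form h x (us @ ws)" if "mset vs = mset ws" for us vs ws
    using that
  proof (induction vs arbitrary: us ws)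
    case (Cons v vs)
    then obtain ws1 ws2 where ws: "ws = ws1 @ v # ws2"
      by (metis list.set_intros(1) mset_eq_setD split_list)
    then have "mset vs = mset (ws1 @ ws2)" using Cons.prems by simp
    then have "jet_form h x ((us @ [v]) @ vs) = jet_form h x ((us @ [v]) @ ws1 @ ws2)"
      by (rule Cons.IH)
    then show ?case using jet_form_to_front[OF assms(1), of us ws1 v ws2] ws by simp
  qed simp
  from this[OF assms(2), of "[]"] show ?thesis by simp
qed

lemma jet_form_tendsto:
  assumes "x \<in> A" "(X \<longlongrightarrow> x) F" "list_all2 (\<lambda>f l. (f \<longlongrightarrow> l) F) fs ls"
  shows "((\<lambda>n. jet_form h (X n) (map (\<lambda>f. f n) fs)) \<longlongrightarrow> jet_form h x ls) F"
  unfolding jet_form_eq_multi_form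
  using isCont_tendsto_compose[OF iter_partial_isCont[OF assms(1)] assms(2)] assms(3)
  by (rule multi_form_tendsto)

lemma jet_form_has_derivative:
  assumes "x \<in> A"
  shows "((\<lambda>x. jet_form h x vs) has_derivative (\<lambda>p. jet_form h x (p # vs))) (at x)"
  unfolding jet_form_eq_multi_form multi_form.simps
  by (rule multi_form_has_derivative)
    (use has_derivative_partial_deriv[OF iter_partial_differentiable[OF assms]] in simp)

text \<open>Maclaurin's formula for \<open>jet_form h (x + t *\<^sub>R p) [w]\<close> as a function
  of \<open>t\<close>, where each differentiation adds one argument \<open>p\<close>.\<close>

lemma jet_form_Taylor:
  assumes "\<And>t. 0 \<le> t \<Longrightarrow> t \<le> 1 \<Longrightarrow> x + t *\<^sub>R p \<in> A" "k > 0"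
  shows "\<exists>t. 0 < t \<and> t < 1 \<and> jet_form h (x + p) [w] =
    (\<Sum>j<k. jet_form h x (replicate j p @ [w]) / fact j)
     + jet_form h (x + t *\<^sub>R p) (replicate k p @ [w]) / fact k"
proof -
  have "DERIV (\<lambda>t. jet_form h (x + t *\<^sub>R p) (replicate m p @ [w])) t :>
      jet_form h (x + t *\<^sub>R p) (replicate (Suc m) p @ [w])" if "0 \<le> t" "t \<le> 1" for m t
  proof -
    have "((\<lambda>t. jet_form h (x + t *\<^sub>R p) (replicate m p @ [w])) has_derivative
        (\<lambda>s. jet_form h (x + t *\<^sub>R p) ((s *\<^sub>R p) # replicate m p @ [w]))) (at t)"
      by (rule has_derivative_compose[where g = "\<lambda>x. jet_form h x (replicate m p @ [w])"
            and f = "\<lambda>t. x + t *\<^sub>R p", OF _ jet_form_has_derivative[OF assms(1)[OF that]]])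
        (auto intro!: derivative_eq_intros)
    moreover have "jet_form h y ((s *\<^sub>R p) # vs) = jet_form h y (p # vs) * s" for y s vs
      using multi_form_scaleR[of "\<lambda>is. iter_partial is h y" "[]" s p vs]
      unfolding jet_form_eq_multi_form by (simp only: append_Nil mult.commute)
    ultimately show ?thesis by (simp add: has_field_derivative_def)
  qed
  then have "\<exists>t>0. t < 1 \<and> jet_form h (x + 1 *\<^sub>R p) [w] =
     (\<Sum>m<k. jet_form h (x + 0 *\<^sub>R p) (replicate m p @ [w]) / fact m * 1 ^ m)
      + jet_form h (x + t *\<^sub>R p) (replicate k p @ [w]) / fact k * 1 ^ k"
    using assms(2) by (intro Maclaurin[where diff = "\<lambda>m t. jet_form h (x + t *\<^sub>R p) (replicate m p @ [w])"]) auto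
  then show ?thesis by auto
qed

lemma jet_form_1: "jet_form h x [w] = grad h x \<bullet> w"
  by (simp add: jet_form_eq_multi_form grad_def inner_vec_def mult.commute)

lemma has_derivative_grad:
  "x \<in> A \<Longrightarrow> (h has_derivative (\<lambda>v. grad h x \<bullet> v)) (at x)"
  using has_derivative_partial_deriv[OF iter_partial_differentiable[of x "[]"]]
  by (simp add: grad_def inner_vec_def mult.commute)

end

subsection \<open>Ultrafilter limits and polynomials\<close>

definition ultrafilter :: "'a filter \<Rightarrow> bool" where
  "ultrafilter F \<longleftrightarrow> F \<noteq> bot \<and> (\<forall>P. eventually P F \<or> eventually (\<lambda>x. \<not> P x) F)"

text \<open>Zorn's lemma for the proper filters below \<open>F\<close>, ordered by reverse
  inclusion. A nonempty chain is a filter base, so its infimum is again proper.\<close>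

lemma ex_ultrafilter_le:
  assumes "F \<noteq> bot"
  shows "\<exists>U\<le>F. ultrafilter U"
proof -
  define S where "S = {G. G \<noteq> bot \<and> G \<le> F}"
  define R where "R = (\<lambda>G H :: 'a filter. H \<le> G)"
  have "\<exists>U\<in>S. \<forall>G\<in>S. R U G \<longrightarrow> G = U"
  proof (rule predicate_Zorn)
    show "partial_order_on S (relation_of R S)"
      by (auto simp: partial_order_on_def preorder_on_def relation_of_def R_def refl_on_def
          trans_def antisym_def)
    fix C assume "C \<in> Chains (relation_of R S)"
    then have C: "C \<subseteq> S" "\<And>G H. G \<in> C \<Longrightarrow> H \<in> C \<Longrightarrow> G \<le> H \<or> H \<le> G"
      unfolding Chains_def relation_of_def R_def by auto
    show "\<exists>u\<in>S. \<forall>a\<in>C. R a u"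
    proof (cases "C = {}")
      case True
      then show ?thesis using assms by (auto simp: S_def)
    next
      case False
      have "eventually P (Inf C) \<longleftrightarrow> (\<exists>G\<in>C. eventually P G)" for P
        using False C(2) by (intro eventually_Inf_base) (auto simp: le_inf_iff)
      then have "Inf C \<noteq> bot" using C(1) by (auto simp: trivial_limit_def S_def)
      moreover have "Inf C \<le> F" using False C(1) by (auto simp: S_def intro: Inf_lower2)
      ultimately show ?thesis by (auto simp: S_def R_def intro: Inf_lower)
    qed
  qed
  then obtain U where "U \<in> S" "\<And>G. G \<in> S \<Longrightarrow> R U G \<Longrightarrow> G = U" by blast
  then have U: "U \<noteq> bot" "U \<le> F" "\<And>G. G \<noteq> bot \<Longrightarrow> G \<le> U \<Longrightarrow> G = U"
    unfolding S_def R_def by (simp_all add: order.trans[of _ U F])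
  \<comment> \<open>Restricting the minimal filter to \<open>P\<close> either yields the trivial
    filter, so that \<open>P\<close> eventually fails, or changes nothing, so that \<open>P\<close>
    eventually holds.\<close>
  have "eventually P U \<or> eventually (\<lambda>x. \<not> P x) U" for P
  proof (cases "inf U (principal {x. P x}) = bot")
    case True
    then show ?thesis by (simp add: trivial_limit_def eventually_inf_principal)
  next
    case False
    then have "inf U (principal {x. P x}) = U" using U(3) by auto
    moreover have "eventually P (inf U (principal {x. P x}))"
      by (simp add: eventually_inf_principal)
    ultimately show ?thesis by simp
  qed
  then show ?thesis using U unfolding ultrafilter_def by blast
qed

text \<open>Compactness gives a cluster point of the image filter. For an ultrafilter a cluster
  point is a limit, since the complement of a neighbourhood cannot hold eventually.\<close>

lemma ultrafilter_tendsto_compact: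
  assumes "ultrafilter F" "compact K" "eventually (\<lambda>n. f n \<in> K) F"
  shows "\<exists>l\<in>K. (f \<longlongrightarrow> l) F"
proof -
  have "filtermap f F \<noteq> bot" using assms(1) by (auto simp: ultrafilter_def filtermap_bot_iff)
  moreover have "eventually (\<lambda>x. x \<in> K) (filtermap f F)" using assms(3) by (simp add: eventually_filtermap)
  ultimately obtain l where l: "l \<in> K" "inf (nhds l) (filtermap f F) \<noteq> bot"
    using assms(2) unfolding compact_filter by blast
  have "(f \<longlongrightarrow> l) F"
  proof (rule topological_tendstoI)
    fix S assume S: "open S" "l \<in> S"
    show "eventually (\<lambda>n. f n \<in> S) F"
    proof (rule ccontr)
      assume "\<not> eventually (\<lambda>n. f n \<in> S) F"
      then have "eventually (\<lambda>n. f n \<notin> S) F" using assms(1) unfolding ultrafilter_def by blast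
      then have "eventually (\<lambda>x. x \<notin> S) (filtermap f F)" by (simp add: eventually_filtermap)
      moreover have "eventually (\<lambda>x. x \<in> S) (nhds l)" using S by (auto simp: eventually_nhds)
      ultimately have "eventually (\<lambda>x. False) (inf (nhds l) (filtermap f F))"
        unfolding eventually_inf by blast
      then show False using l(2) by (simp add: trivial_limit_def)
    qed
  qed
  then show ?thesis using l(1) by blast
qed

lemma ultrafilter_tendsto_bounded:
  fixes f :: "'a \<Rightarrow> 'b::heine_borel"
  assumes "ultrafilter F" "eventually (\<lambda>n. dist a (f n) \<le> B) F"
  shows "\<exists>l. (f \<longlongrightarrow> l) F"
  using ultrafilter_tendsto_compact[OF assms(1) compact_cball[of a B]] assms(2) by auto

text \<open>The coefficients may be unbounded, so they are divided by the sum \<open>N\<close> of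
  their absolute values. If \<open>N\<close> did not tend to 0, the normalised polynomials would
  converge to a nonzero polynomial with a root of every modulus in the unit interval, which is
  impossible.\<close>

lemma poly_coeffs_tendsto_0:
  fixes c :: "nat \<Rightarrow> 'a \<Rightarrow> real"
  assumes F: "ultrafilter F"
    and ex: "\<And>r. 0 \<le> r \<Longrightarrow> r \<le> 1 \<Longrightarrow> \<exists>s l. (s \<longlongrightarrow> l) F \<and> \<bar>l\<bar> = r \<and> ((\<lambda>n. \<Sum>j\<le>k. c j n * s n ^ j) \<longlongrightarrow> 0) F"
    and "i \<le> k"
  shows "(c i \<longlongrightarrow> 0) F"
proof -
  define N where "N n = (\<Sum>j\<le>k. \<bar>c j n\<bar>)" for n
  have nb: "F \<noteq> bot" using F by (simp add: ultrafilter_def)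
  have le: "\<bar>c j n\<bar> \<le> N n" if "j \<le> k" for j n
    unfolding N_def using that by (intro member_le_sum) auto
  have "(N \<longlongrightarrow> 0) F"
  proof (rule ccontr)
    assume "\<not> (N \<longlongrightarrow> 0) F"
    then obtain e where e: "e > 0" "\<not> eventually (\<lambda>n. dist (N n) 0 < e) F"
      unfolding tendsto_iff by blast
    then have "eventually (\<lambda>n. \<not> dist (N n) 0 < e) F" using F unfolding ultrafilter_def by blast
    then have Ne: "eventually (\<lambda>n. e \<le> N n) F"
      by eventually_elim (simp add: N_def sum_nonneg)
    have "\<exists>l. ((\<lambda>n. c j n / N n) \<longlongrightarrow> l) F" if "j \<le> k" for j
    proof (rule ultrafilter_tendsto_bounded[OF F])
      show "eventually (\<lambda>n. dist 0 (c j n / N n) \<le> 1) F"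
        using Ne by eventually_elim (use e(1) le[OF that] in \<open>auto simp: divide_simps\<close>)
    qed
    then have "\<forall>j\<in>{..k}. \<exists>l. ((\<lambda>n. c j n / N n) \<longlongrightarrow> l) F" by simp
    from bchoice[OF this] obtain C where C: "\<And>j. j \<le> k \<Longrightarrow> ((\<lambda>n. c j n / N n) \<longlongrightarrow> C j) F"
      by auto
    have "((\<lambda>n. \<Sum>j\<le>k. \<bar>c j n / N n\<bar>) \<longlongrightarrow> (\<Sum>j\<le>k. \<bar>C j\<bar>)) F"
      by (intro tendsto_sum tendsto_rabs C) simp
    moreover have "eventually (\<lambda>n. (\<Sum>j\<le>k. \<bar>c j n / N n\<bar>) = 1) F"
      using Ne
    proof eventually_elim
      case (elim n)
      then have "(\<Sum>j\<le>k. \<bar>c j n / N n\<bar>) = (\<Sum>j\<le>k. \<bar>c j n\<bar>) / N n"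
        using e(1) by (simp add: sum_divide_distrib)
      then show ?case using elim e(1) by (simp flip: N_def)
    qed
    \<comment> \<open>The normalisation passes to the limit, so the limit polynomial is not
      zero.\<close>
    ultimately have "(\<Sum>j\<le>k. \<bar>C j\<bar>) = 1"
      by (rule tendsto_unique[OF nb _ tendsto_eventually])
    then have "\<exists>j\<le>k. C j \<noteq> 0" by (intro ccontr[of "\<exists>j\<le>k. C j \<noteq> 0"]) simp
    then have fin: "finite {x. (\<Sum>j\<le>k. C j * x ^ j) = 0}"
      by (simp add: Transcendental.polyfun_finite_roots)
    have "{0..1} \<subseteq> abs ` {x. (\<Sum>j\<le>k. C j * x ^ j) = 0}"
    proof
      fix r :: real assume "r \<in> {0..1}"
      then obtain s l where s: "(s \<longlongrightarrow> l) F" "\<bar>l\<bar> = r" "((\<lambda>n. \<Sum>j\<le>k. c j n * s n ^ j) \<longlongrightarrow> 0) F"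
        using ex[of r] unfolding atLeastAtMost_iff by blast
      have "((\<lambda>n. (\<Sum>j\<le>k. c j n * s n ^ j) / N n) \<longlongrightarrow> 0) F"
      proof (rule tendsto_0_le[OF s(3)])
        show "\<forall>\<^sub>F n in F. norm ((\<Sum>j\<le>k. c j n * s n ^ j) / N n) \<le> norm (\<Sum>j\<le>k. c j n * s n ^ j) * (1 / e)"
          using Ne
        proof eventually_elim
          case (elim n)
          then have "\<bar>x\<bar> / N n \<le> \<bar>x\<bar> / e" for x using e(1) by (intro divide_left_mono) auto
          then show ?case using elim e(1) by simp
        qed
      qed
      moreover have "((\<lambda>n. (\<Sum>j\<le>k. c j n * s n ^ j) / N n) \<longlongrightarrow> (\<Sum>j\<le>k. C j * l ^ j)) F"
      proof -
        have "((\<lambda>n. \<Sum>j\<le>k. c j n / N n * s n ^ j) \<longlongrightarrow> (\<Sum>j\<le>k. C j * l ^ j)) F"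
          by (intro tendsto_sum tendsto_mult tendsto_power C s(1)) simp
        then show ?thesis by (simp add: sum_divide_distrib)
      qed
      ultimately have "(\<Sum>j\<le>k. C j * l ^ j) = 0" by (rule tendsto_unique[OF nb, symmetric])
      then show "r \<in> abs ` {x. (\<Sum>j\<le>k. C j * x ^ j) = 0}" using s(2) by blast
    qed
    then have "finite {0..1::real}" by (rule finite_surj[OF fin])
    then show False using infinite_Icc[of 0 "1::real"] by simp
  qed
  then show ?thesis
  proof (rule tendsto_0_le[where K = 1])
    show "\<forall>\<^sub>F n in F. norm (c i n) \<le> norm (N n) * 1"
      using le[OF \<open>i \<le> k\<close>] by (intro always_eventually allI) (simp, smt (verit))
  qed
qed

text \<open>Intermediate value theorem for a sign change of unknown orientation. It serves odd
  functions on a half circle and the off-diagonal entry of a quadratic form under a quarter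
  turn.\<close>

lemma ex_zero_antisymmetric_endpoints:
  fixes g :: "real \<Rightarrow> real"
  assumes "continuous_on {a..b} g" "a \<le> b" "g b = - g a"
  shows "\<exists>x. g x = 0"
proof (cases "g a \<le> 0")
  case True
  then show ?thesis using IVT'[of g a 0 b] assms by auto
next
  case False
  then show ?thesis using IVT2'[of g b 0 a] assms by auto
qed

text \<open>Multiplying the second equation by \<open>(A11 + b y)\<^sup>2\<close> and eliminating \<open>x\<close> by means of the
  first one leaves a quartic in \<open>y\<close> with leading coefficient \<open>b (4 b k - 3 c\<^sup>2) / 8\<close>.\<close>

lemma finite_critical_points_cubic:
  fixes b c k A11 A12 A22 :: real
  assumes "b \<noteq> 0" "4 * b * k \<noteq> 3 * c\<^sup>2"
  shows "finite {(x, y). A11 * x + A12 * y + b * x * y + c * y\<^sup>2 / 2 = 0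
    \<and> A12 * x + A22 * y + b * x\<^sup>2 / 2 + c * x * y + k * y\<^sup>2 / 2 = 0}" (is "finite ?S")
proof -
  \<comment> \<open>\<open>p\<close> lists the coefficients of the eliminated quartic in
    \<open>y\<close>. \<open>q y\<close> lists those of the second equation as a quadratic in
    \<open>x\<close>; its leading coefficient \<open>b / 2\<close> is nonzero, so each
    \<open>y\<close> allows only finitely many \<open>x\<close>.\<close>
  define p where "p = (\<lambda>i::nat. [0,
     - A12 * A12 * A11 + A22 * A11\<^sup>2,
     - A12 * (A12 * b + c * A11 / 2) + 2 * A22 * A11 * b + b * A12\<^sup>2 / 2 - c * A12 * A11 + k * A11\<^sup>2 / 2,
     - A12 * c * b / 2 + A22 * b\<^sup>2 + b * A12 * c / 2 - c * (A12 * b + c * A11 / 2) + k * A11 * b,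
     b * (4 * b * k - 3 * c\<^sup>2) / 8] ! i)"
  define q where "q = (\<lambda>y. (\<lambda>i::nat. [A22 * y + k * y\<^sup>2 / 2, A12 + c * y, b / 2] ! i))"
  have "finite {y. (\<Sum>i\<le>4. p i * y ^ i) = 0}"
    unfolding Transcendental.polyfun_finite_roots
    by (rule exI[of _ 4]) (use assms in \<open>simp add: p_def\<close>)
  moreover have "finite {x. (\<Sum>i\<le>2. q y i * x ^ i) = 0}" for y
    unfolding Transcendental.polyfun_finite_roots
    by (rule exI[of _ 2]) (use assms in \<open>simp add: q_def\<close>)
  ultimately have "finite (prod.swap ` Sigma {y. (\<Sum>i\<le>4. p i * y ^ i) = 0} (\<lambda>y. {x. (\<Sum>i\<le>2. q y i * x ^ i) = 0}))"
    by (intro finite_imageI finite_SigmaI) auto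
  moreover have "?S \<subseteq> prod.swap ` Sigma {y. (\<Sum>i\<le>4. p i * y ^ i) = 0} (\<lambda>y. {x. (\<Sum>i\<le>2. q y i * x ^ i) = 0})"
  proof clarify
    fix x y
    assume 1: "A11 * x + A12 * y + b * x * y + c * y\<^sup>2 / 2 = 0"
      and 2: "A12 * x + A22 * y + b * x\<^sup>2 / 2 + c * x * y + k * y\<^sup>2 / 2 = 0"
    have "(\<Sum>i\<le>4. p i * y ^ i) = 0"
    proof -
      define L where "L = A11 + b * y"
      define M where "M = A12 + c * y / 2"
      have xL: "x * L = - (y * M)" using 1 by (simp add: L_def M_def power2_eq_square algebra_simps)
      have "0 = L\<^sup>2 * (A12 * x + A22 * y + b * x\<^sup>2 / 2 + c * x * y + k * y\<^sup>2 / 2)" using 2 by simp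
      also have "\<dots> = A12 * (x * L) * L + A22 * y * L\<^sup>2 + b * (x * L)\<^sup>2 / 2 + c * y * L * (x * L) + k * y\<^sup>2 * L\<^sup>2 / 2"
        by (simp add: power2_eq_square algebra_simps)
      also have "\<dots> = (\<Sum>i\<le>4. p i * y ^ i)"
      proof -
        \<comment> \<open>Writing the parameters as doubles removes the fractions, and the
          elimination becomes a polynomial identity.\<close>
        obtain b' c' k' where half: "b = 2 * b'" "c = 2 * c'" "k = 2 * k'"
          by (metis mult_2 field_sum_of_halves)
        have sum: "(\<Sum>i\<le>4. p i * y ^ i) = p 0 + p 1 * y + p 2 * y ^ 2 + p 3 * y ^ 3 + p 4 * y ^ 4"
          by (simp add: numeral_eq_Suc)
        have p: "p 0 = 0" "p 1 = - A12 * A12 * A11 + A22 * A11\<^sup>2"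
          "p 2 = - A12 * (A12 * b + c' * A11) + 2 * A22 * A11 * b + b' * A12\<^sup>2 - c * A12 * A11 + k' * A11\<^sup>2"
          "p 3 = - A12 * c' * b + A22 * b\<^sup>2 + b * A12 * c' - c * (A12 * b + c' * A11) + k * A11 * b"
          "p 4 = b' * (4 * b' * k' - 3 * c'\<^sup>2)"
          by (simp_all add: p_def half power2_eq_square)
        show ?thesis
          unfolding xL sum p unfolding L_def M_def half
          by (simp add: algebra_simps add_divide_distrib power2_eq_square power3_eq_cube power4_eq_xxxx)
      qed
      finally show ?thesis by simp
    qed
    moreover have "(\<Sum>i\<le>2. q y i * x ^ i) = 0"
      using 2 by (simp add: q_def numeral_eq_Suc power2_eq_square algebra_simps)
    ultimately show "(x, y) \<in> prod.swap ` Sigma {y. (\<Sum>i\<le>4. p i * y ^ i) = 0} (\<lambda>y. {x. (\<Sum>i\<le>2. q y i * x ^ i) = 0})"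
      by (auto simp: image_iff)
  qed
  ultimately show ?thesis by (rule rev_finite_subset)
qed

text \<open>After transposition the vectors are the columns, as in the rank conditions of the
  theorem. Orthogonal vectors suffice, since every pair or triple that is to violate such a
  condition is chosen orthogonal.\<close>

lemma rank_transpose_vector_2_orthogonal:
  fixes u v :: "real^'n"
  assumes "u \<noteq> 0" "v \<noteq> 0" "u \<bullet> v = 0"
  shows "rank (transpose (vector [u, v] :: real^'n^2)) = 2"
proof -
  have "rows (vector [u, v] :: real^'n^2) = {u, v}"
    unfolding rows_def Setcompr_eq_image UNIV_2 by (simp add: row_def)
  moreover have "independent {u, v}"
    using assms by (intro pairwise_orthogonal_independent)
      (auto simp: pairwise_def orthogonal_def inner_commute)
  moreover have "u \<noteq> v" using assms by auto
  ultimately show ?thesis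
    unfolding rank_transpose unfolding row_rank_def by (simp add: dim_eq_card_independent)
qed

lemma rank_transpose_vector_3_orthogonal:
  fixes u v w :: "real^'n"
  assumes "u \<noteq> 0" "v \<noteq> 0" "w \<noteq> 0" "u \<bullet> v = 0" "u \<bullet> w = 0" "v \<bullet> w = 0"
  shows "rank (transpose (vector [u, v, w] :: real^'n^3)) = 3"
proof -
  have "rows (vector [u, v, w] :: real^'n^3) = {u, v, w}"
    unfolding rows_def Setcompr_eq_image UNIV_3 by (simp add: row_def)
  moreover have "independent {u, v, w}"
    using assms by (intro pairwise_orthogonal_independent)
      (auto simp: pairwise_def orthogonal_def inner_commute)
  moreover have "u \<noteq> v" "u \<noteq> w" "v \<noteq> w" using assms by auto
  ultimately show ?thesis
    unfolding rank_transpose unfolding row_rank_def by (simp add: dim_eq_card_independent)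
qed

subsection \<open>Sequences of flat points\<close>

lemma affine_direction_eq:
  assumes "affine L" "x \<in> L" "y \<in> L"
  shows "(\<lambda>z. z - x) ` L = (\<lambda>z. z - y) ` L"
proof -
  have "(\<lambda>z. z - x) ` L \<subseteq> (\<lambda>z. z - y) ` L" if "x \<in> L" "y \<in> L" for x y
  proof
    fix w assume "w \<in> (\<lambda>z. z - x) ` L"
    then obtain z where z: "z \<in> L" "w = z - x" by blast
    have "z - x + y \<in> L" using mem_affine_3_minus[OF assms(1) \<open>y \<in> L\<close> z(1) \<open>x \<in> L\<close>, of 1] by (simp add: algebra_simps)
    moreover have "w = (z - x + y) - y" by (simp add: z(2))
    ultimately show "w \<in> (\<lambda>z. z - y) ` L" by (rule rev_image_eqI)
  qed
  then show ?thesis using assms by blast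
qed

context smooth_on_open
begin

text \<open>The vector described by \<open>restr_grad\<close> is the orthogonal projection of the
  full gradient onto the direction space of \<open>L\<close>. Both its existence and its uniqueness
  must be shown before the definite description can be used.\<close>

lemma restr_grad_properties:
  assumes "x \<in> A" "affine L" "x \<in> L"
  shows "restr_grad h L x \<in> (\<lambda>y. y - x) ` L"
    and "\<And>w. w \<in> (\<lambda>y. y - x) ` L \<Longrightarrow> restr_grad h L x \<bullet> w = grad h x \<bullet> w"
proof -
  define V where "V = (\<lambda>y. y - x) ` L"
  have V: "subspace V" unfolding V_def using assms(2,3) by (rule affine_diffs_subspace_subtract)
  obtain g z where g: "g \<in> V" "\<And>w. w \<in> V \<Longrightarrow> orthogonal z w" "grad h x = g + z"
    using orthogonal_subspace_decomp_exists[of V "grad h x"] span_eq_iff[of V] V by metis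
  have gw: "g \<bullet> w = grad h x \<bullet> w" if "w \<in> V" for w
    using g(2)[OF that] by (simp add: g(3) inner_add_left orthogonal_def)
  have der: "(h has_derivative (\<lambda>v. g \<bullet> v)) (at x within L)"
  proof -
    have "(h has_derivative (\<lambda>v. grad h x \<bullet> v)) (at x within L)"
      using has_derivative_grad[OF assms(1)] by (rule has_derivative_at_withinI)
    then have "((\<lambda>y. (1 / norm (y - x)) *\<^sub>R (h y - (h x + grad h x \<bullet> (y - x)))) \<longlongrightarrow> 0) (at x within L)"
      unfolding has_derivative_within by blast
    moreover have "eventually (\<lambda>y. (1 / norm (y - x)) *\<^sub>R (h y - (h x + grad h x \<bullet> (y - x)))
        = (1 / norm (y - x)) *\<^sub>R (h y - (h x + g \<bullet> (y - x)))) (at x within L)"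
      unfolding eventually_at_filter by (rule always_eventually) (auto simp: gw V_def)
    ultimately have "((\<lambda>y. (1 / norm (y - x)) *\<^sub>R (h y - (h x + g \<bullet> (y - x)))) \<longlongrightarrow> 0) (at x within L)"
      by (rule Lim_transform_eventually)
    then show ?thesis unfolding has_derivative_within by (simp add: bounded_linear_inner_right)
  qed
  have uniq: "g' = g" if "g' \<in> V" "(h has_derivative (\<lambda>v. g' \<bullet> v)) (at x within L)" for g'
  proof -
    define d where "d = g' - g"
    have "d \<in> V" unfolding d_def using V that(1) g(1) by (rule subspace_diff)
    \<comment> \<open>The line through \<open>x\<close> in the direction of the difference stays in
      \<open>L\<close>. Comparing the derivatives of \<open>h\<close> along it gives
      \<open>d \<bullet> d = 0\<close>.\<close>
    have sub: "(\<lambda>t::real. x + t *\<^sub>R d) ` UNIV \<subseteq> L"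
    proof
      fix y assume "y \<in> (\<lambda>t::real. x + t *\<^sub>R d) ` UNIV"
      then obtain t where t: "y = x + t *\<^sub>R d" by blast
      have "t *\<^sub>R d \<in> V" using V \<open>d \<in> V\<close> by (rule subspace_scale)
      then show "y \<in> L" unfolding V_def t by auto
    qed
    have path: "((\<lambda>t::real. h (x + t *\<^sub>R d)) has_derivative (\<lambda>t. f \<bullet> (t *\<^sub>R d))) (at 0)"
      if "(h has_derivative (\<lambda>v. f \<bullet> v)) (at x within L)" for f
    proof (rule has_derivative_in_compose[where g = h and f = "\<lambda>t. x + t *\<^sub>R d"])
      show "((\<lambda>t. x + t *\<^sub>R d) has_derivative (\<lambda>t. t *\<^sub>R d)) (at 0)"
        by (auto intro!: derivative_eq_intros)
      show "(h has_derivative (\<lambda>v. f \<bullet> v)) (at (x + 0 *\<^sub>R d) within range (\<lambda>t. x + t *\<^sub>R d))"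
        using has_derivative_subset[OF that sub] by simp
    qed
    have "(\<lambda>t. g' \<bullet> (t *\<^sub>R d)) = (\<lambda>t. g \<bullet> (t *\<^sub>R d))"
      by (rule has_derivative_unique[OF path[OF that(2)] path[OF der]])
    then have "g' \<bullet> (1 *\<^sub>R d) = g \<bullet> (1 *\<^sub>R d)" by (rule fun_cong)
    then have "d \<bullet> d = 0" by (simp add: d_def inner_diff_left)
    then show ?thesis by (simp add: d_def)
  qed
  have "restr_grad h L x = g"
    unfolding restr_grad_def V_def[symmetric]
    by (rule the_equality) (use g(1) der uniq in blast)+
  then show "restr_grad h L x \<in> (\<lambda>y. y - x) ` L"
    "\<And>w. w \<in> (\<lambda>y. y - x) ` L \<Longrightarrow> restr_grad h L x \<bullet> w = grad h x \<bullet> w"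
    using g(1) gw by (auto simp: V_def)
qed

text \<open>A projection does not increase the norm. This bounds the infima over spheres from above,
  as needed for handling their supremum.\<close>

lemma norm_restr_grad_le:
  assumes "x \<in> A" "affine L" "x \<in> L"
  shows "norm (restr_grad h L x) \<le> norm (grad h x)"
proof -
  have "norm (restr_grad h L x) ^ 2 = grad h x \<bullet> restr_grad h L x"
    using restr_grad_properties[OF assms] by (metis power2_norm_eq_inner)
  also have "\<dots> \<le> norm (grad h x) * norm (restr_grad h L x)" by (rule norm_cauchy_schwarz)
  finally have "norm (restr_grad h L x) * norm (restr_grad h L x) \<le> norm (grad h x) * norm (restr_grad h L x)"
    by (simp add: power2_eq_square)
  then show ?thesis
    by (metis mult_right_le_imp_le norm_ge_zero order_le_less)
qed

lemma isCont_grad: "x \<in> A \<Longrightarrow> isCont (grad h) x"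
  using iter_partial_isCont[of x "[_]"] unfolding grad_def
  by (auto simp: isCont_def intro!: vec_tendstoI)

text \<open>Failure of the steepness inequality at one scale means that the infimum over each
  smaller sphere is at most \<open>B\<close>. The doubled bound is strictly larger, so a point below
  it exists without attainment of the infimum.\<close>

lemma small_grad_points:
  assumes m: "m \<ge> 1" and L: "L \<in> orth_affine_subspaces h m J" and sub: "cball J \<xi> \<subseteq> A" and "0 < \<xi>"
    and "\<not> (SUP \<eta>\<in>{0..\<xi>}. INF y\<in>L \<inter> sphere J \<eta>. norm (restr_grad h L y)) > B" and "B > 0"
    and \<eta>: "0 \<le> \<eta>" "\<eta> \<le> \<xi>"
  shows "\<exists>p\<in>(\<lambda>y. y - J) ` L. norm p = \<eta> \<and> (\<forall>w\<in>(\<lambda>y. y - J) ` L. \<bar>grad h (J + p) \<bullet> w\<bar> \<le> 2 * B * norm w)"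
proof -
  define V where "V = (\<lambda>y. y - J) ` L"
  have aff: "affine L" "J \<in> L" "aff_dim L = int m" using L by (auto simp: orth_affine_subspaces_def)
  have V: "subspace V" unfolding V_def using aff(1,2) by (rule affine_diffs_subspace_subtract)
  have "dim V = m" using aff_dim_dim_affine_diffs[OF aff(1,2)] aff(3) by (simp add: V_def)
  \<comment> \<open>Positive dimension makes all spheres in \<open>L\<close> nonempty, so the infima
    are taken over nonempty sets.\<close>
  then have "V \<noteq> {0}" using m by auto
  then obtain d where d: "d \<in> V" "d \<noteq> 0" using subspace_0[OF V] by blast
  have ne: "L \<inter> sphere J s \<noteq> {}" if "0 \<le> s" for s
  proof -
    have "(s / norm d) *\<^sub>R d \<in> V" using V d(1) by (rule subspace_scale)
    then have "J + (s / norm d) *\<^sub>R d \<in> L" unfolding V_def by auto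
    moreover have "J + (s / norm d) *\<^sub>R d \<in> sphere J s" using d(2) that by (simp add: dist_norm)
    ultimately show ?thesis by blast
  qed
  have "continuous_on (cball J \<xi>) (grad h)"
    using sub by (auto intro!: continuous_at_imp_continuous_on isCont_grad)
  then have "bounded (grad h ` cball J \<xi>)"
    using compact_continuous_image compact_cball compact_imp_bounded by blast
  then obtain K where K: "\<And>y. y \<in> cball J \<xi> \<Longrightarrow> norm (grad h y) \<le> K"
    unfolding bounded_iff by blast
  define I where "I s = (INF y\<in>L \<inter> sphere J s. norm (restr_grad h L y))" for s
  have bb: "bdd_below ((\<lambda>y. norm (restr_grad h L y)) ` S)" for S by (rule bdd_belowI[where m = 0]) auto
  have IK: "I s \<le> K" if s: "s \<in> {0..\<xi>}" for s
  proof -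
    obtain y where y: "y \<in> L" "y \<in> sphere J s" using ne s by fastforce
    then have yc: "y \<in> cball J \<xi>" using s by simp
    have "I s \<le> norm (restr_grad h L y)" unfolding I_def using y by (intro cINF_lower bb) auto
    also have "\<dots> \<le> norm (grad h y)" using y(1) yc sub by (intro norm_restr_grad_le aff(1)) auto
    also have "\<dots> \<le> K" using yc by (rule K)
    finally show ?thesis .
  qed
  have "I \<eta> \<le> (SUP s\<in>{0..\<xi>}. I s)"
    using \<eta> IK by (intro cSUP_upper bdd_aboveI[where M = K]) auto
  also have "\<dots> \<le> B" using assms(5) by (simp add: I_def not_less)
  also have "\<dots> < 2 * B" using \<open>B > 0\<close> by simp
  finally have "\<exists>y\<in>L \<inter> sphere J \<eta>. norm (restr_grad h L y) < 2 * B"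
    unfolding I_def using cINF_less_iff[OF ne[OF \<eta>(1)] bb] by blast
  then obtain y where y: "y \<in> L" "dist J y = \<eta>" "norm (restr_grad h L y) < 2 * B" by auto
  have yA: "y \<in> A" using y(2) \<eta>(2) sub by auto
  have dir: "(\<lambda>z. z - y) ` L = V" unfolding V_def by (rule affine_direction_eq[OF aff(1) y(1) aff(2)])
  show ?thesis
  proof (intro bexI conjI ballI)
    show "norm (y - J) = \<eta>" using y(2) by (simp add: dist_norm norm_minus_commute)
    fix w assume "w \<in> (\<lambda>y. y - J) ` L"
    then have "grad h y \<bullet> w = restr_grad h L y \<bullet> w"
      using restr_grad_properties(2)[OF yA aff(1) y(1)] dir by (simp add: V_def)
    then have "\<bar>grad h y \<bullet> w\<bar> \<le> norm (restr_grad h L y) * norm w"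
      by (simp add: Cauchy_Schwarz_ineq2)
    also have "\<dots> \<le> 2 * B * norm w" using y(3) by (intro mult_right_mono) auto
    finally show "\<bar>grad h (J + (y - J)) \<bullet> w\<bar> \<le> 2 * B * norm w" by simp
  qed (use y(1) in auto)
qed

end

text \<open>The rescaled data of a failure of steepness with index 4: base points
  \<open>X n\<close>, direction spaces \<open>V n\<close>, scales \<open>\<xi> n\<close>, and for
  each radius \<open>r\<close> a point \<open>Q n r\<close> of norm \<open>r\<close>. The power 4 in
  \<open>grad_small\<close> is the steepness index, and \<open>\<epsilon> n\<close> absorbs the
  shrinking steepness coefficient.\<close>

locale flat_sequence = smooth_on_open A h for A :: "(real^'n::finite) set" and h +
  fixes m :: nat and x :: "real^'n" and X :: "nat \<Rightarrow> real^'n" and V :: "nat \<Rightarrow> (real^'n) set"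
    and \<xi> :: "nat \<Rightarrow> real" and \<epsilon> :: "nat \<Rightarrow> real" and Q :: "nat \<Rightarrow> real \<Rightarrow> real^'n" and F :: "nat filter"
  assumes x: "x \<in> A" and F: "ultrafilter F"
    and X: "(X \<longlongrightarrow> x) F" and \<xi>: "(\<xi> \<longlongrightarrow> 0) F" and \<epsilon>: "(\<epsilon> \<longlongrightarrow> 0) F"
    and \<xi>_pos: "\<And>n. \<xi> n > 0"
    and cball_sub: "\<And>n. cball (X n) (\<xi> n) \<subseteq> A"
    and subspace_V: "\<And>n. subspace (V n)" and dim_V: "\<And>n. dim (V n) = m"
    and V_orth: "\<And>n v. v \<in> V n \<Longrightarrow> grad h (X n) \<bullet> v = 0"
    and Q_in: "\<And>n r. 0 \<le> r \<Longrightarrow> r \<le> 1 \<Longrightarrow> Q n r \<in> V n"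
    and norm_Q: "\<And>n r. 0 \<le> r \<Longrightarrow> r \<le> 1 \<Longrightarrow> norm (Q n r) = r"
    and grad_small: "\<And>n r w. 0 \<le> r \<Longrightarrow> r \<le> 1 \<Longrightarrow> w \<in> V n \<Longrightarrow>
        \<bar>grad h (X n + \<xi> n *\<^sub>R Q n r) \<bullet> w\<bar> \<le> \<epsilon> n * \<xi> n ^ 4 * norm w"

text \<open>Negating the claim with the same number \<open>\<rho> n\<close> as neighbourhood radius,
  coefficient and range of scales produces a flat sequence as \<open>\<rho> n\<close> tends to
  0.\<close>

lemma (in smooth_on_open) steep_nbhd_or_flat_sequence:
  assumes "x \<in> A" "m \<ge> 1"
    and no_flat: "\<And>X V \<xi> \<epsilon> Q F. \<not> flat_sequence A h m x X V \<xi> \<epsilon> Q F"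
  shows "\<exists>r>0. \<exists>C>0. \<exists>\<delta>>0. \<forall>J\<in>ball x r. steep_ineq A h m C \<delta> 4 J"
proof (rule ccontr)
  assume neg: "\<not> ?thesis"
  obtain R where R: "R > 0" "cball x R \<subseteq> A" using open_A assms(1) open_contains_cball by blast
  \<comment> \<open>The bound \<open>R / 2\<close> ensures that a ball of radius
    \<open>\<rho> n\<close> about a point of \<open>ball x (\<rho> n)\<close> stays in
    \<open>cball x R\<close>, hence in \<open>A\<close>.\<close>
  define \<rho> where "\<rho> n = min (R / 2) (1 / real (Suc n))" for n
  have \<rho>: "\<rho> n > 0" "\<rho> n \<le> R / 2" "\<rho> n \<le> 1 / real (Suc n)" for n using R(1) by (auto simp: \<rho>_def)
  have \<rho>0: "\<rho> \<longlonglongrightarrow> 0"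
    by (rule tendsto_sandwich[OF _ _ tendsto_const LIMSEQ_Suc[OF lim_1_over_n]])
      (use \<rho> in \<open>auto intro!: always_eventually less_imp_le\<close>)
  have "\<exists>J L \<xi>. J \<in> ball x (\<rho> n) \<and> L \<in> orth_affine_subspaces h m J \<and> 0 < \<xi> \<and> \<xi> \<le> \<rho> n \<and> cball J \<xi> \<subseteq> A
      \<and> \<not> (SUP \<eta>\<in>{0..\<xi>}. INF y\<in>L \<inter> sphere J \<eta>. norm (restr_grad h L y)) > \<rho> n * \<xi> powr 4" for n
  proof -
    obtain J where J: "J \<in> ball x (\<rho> n)" "\<not> steep_ineq A h m (\<rho> n) (\<rho> n) 4 J"
      using neg \<rho>(1)[of n] by blast
    have sub: "cball J (\<rho> n) \<subseteq> A"
    proof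
      fix y assume "y \<in> cball J (\<rho> n)"
      then have "dist x y \<le> R" using J(1) \<rho>(2)[of n] dist_triangle[of x y J] by auto
      then show "y \<in> A" using R(2) by auto
    qed
    then obtain L \<xi> where "L \<in> orth_affine_subspaces h m J" "0 < \<xi>" "\<xi> \<le> \<rho> n"
      "\<not> (SUP \<eta>\<in>{0..\<xi>}. INF y\<in>L \<inter> sphere J \<eta>. norm (restr_grad h L y)) > \<rho> n * \<xi> powr 4"
      using J(2) unfolding steep_ineq_def by (auto simp del: powr_numeral)
    moreover from this have "cball J \<xi> \<subseteq> A" using sub subset_cball[of \<xi> "\<rho> n" J] by auto
    ultimately show ?thesis using J(1) by blast
  qed
  then obtain J L \<xi> where J: "\<And>n. J n \<in> ball x (\<rho> n)" and L: "\<And>n. L n \<in> orth_affine_subspaces h m (J n)"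
    and \<xi>: "\<And>n. 0 < \<xi> n" "\<And>n. \<xi> n \<le> \<rho> n" "\<And>n. cball (J n) (\<xi> n) \<subseteq> A"
    and sup: "\<And>n. \<not> (SUP \<eta>\<in>{0..\<xi> n}. INF y\<in>L n \<inter> sphere (J n) \<eta>. norm (restr_grad h (L n) y)) > \<rho> n * \<xi> n powr 4"
    by metis
  define V where "V n = (\<lambda>y. y - J n) ` L n" for n
  have V: "subspace (V n)" for n
    unfolding V_def using L[of n] by (intro affine_diffs_subspace_subtract) (auto simp: orth_affine_subspaces_def)
  have ex_Q: "\<exists>q\<in>V n. norm q = r \<and> (\<forall>w\<in>V n. \<bar>grad h (J n + \<xi> n *\<^sub>R q) \<bullet> w\<bar> \<le> 2 * \<rho> n * \<xi> n ^ 4 * norm w)"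
    if r: "0 \<le> r" "r \<le> 1" for n r
  proof -
    have "0 \<le> r * \<xi> n" "r * \<xi> n \<le> \<xi> n" using r \<xi>(1)[of n] by (auto intro: mult_left_le_one_le)
    moreover have "\<rho> n * \<xi> n powr 4 > 0" using \<rho>(1)[of n] \<xi>(1)[of n] by simp
    ultimately obtain p where p: "p \<in> V n" "norm p = r * \<xi> n"
      "\<And>w. w \<in> V n \<Longrightarrow> \<bar>grad h (J n + p) \<bullet> w\<bar> \<le> 2 * (\<rho> n * \<xi> n powr 4) * norm w"
      using small_grad_points[OF assms(2) L \<xi>(3) \<xi>(1) sup, of n "r * \<xi> n"]
      unfolding V_def by blast
    have "\<xi> n powr 4 = \<xi> n ^ 4" using \<xi>(1)[of n] powr_numeral[of "\<xi> n" "num.Bit0 (num.Bit0 num.One)"] by simp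
    moreover have "(1 / \<xi> n) *\<^sub>R p \<in> V n" using V p(1) by (rule subspace_scale)
    ultimately show ?thesis using p \<xi>(1)[of n]
      by (intro bexI[of _ "(1 / \<xi> n) *\<^sub>R p"]) (auto simp: mult.assoc)
  qed
  define Q where "Q n r = (SOME q. q \<in> V n \<and> norm q = r \<and>
    (\<forall>w\<in>V n. \<bar>grad h (J n + \<xi> n *\<^sub>R q) \<bullet> w\<bar> \<le> 2 * \<rho> n * \<xi> n ^ 4 * norm w))" for n r
  have Q: "Q n r \<in> V n \<and> norm (Q n r) = r \<and>
      (\<forall>w\<in>V n. \<bar>grad h (J n + \<xi> n *\<^sub>R Q n r) \<bullet> w\<bar> \<le> 2 * \<rho> n * \<xi> n ^ 4 * norm w)"
    if "0 \<le> r" "r \<le> 1" for n r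
    unfolding Q_def by (rule someI_ex) (use ex_Q[OF that] in blast)
  obtain F where F: "F \<le> sequentially" "ultrafilter F"
    using ex_ultrafilter_le[of sequentially] by auto
  have "(\<lambda>n. dist (J n) x) \<longlonglongrightarrow> 0"
  proof (rule tendsto_sandwich[OF always_eventually always_eventually tendsto_const \<rho>0]; rule allI)
    show "dist (J n) x \<le> \<rho> n" for n using J[of n] by (simp add: dist_commute)
  qed simp
  then have "J \<longlonglongrightarrow> x" by (rule tendsto_dist_iff[THEN iffD2])
  moreover have "\<xi> \<longlonglongrightarrow> 0"
    by (rule tendsto_sandwich[OF always_eventually always_eventually tendsto_const \<rho>0]; rule allI)
      (rule less_imp_le[OF \<xi>(1)] \<xi>(2))+
  \<comment> \<open>The factor 2 is the one lost in \<open>small_grad_points\<close>.\<close>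
  moreover have "(\<lambda>n. 2 * \<rho> n) \<longlonglongrightarrow> 0" using tendsto_mult_right_zero[OF \<rho>0] by blast
  ultimately have "flat_sequence A h m x J V \<xi> (\<lambda>n. 2 * \<rho> n) Q F"
  proof unfold_locales
    show "dim (V n) = m" "\<And>v. v \<in> V n \<Longrightarrow> grad h (J n) \<bullet> v = 0" for n
      using L[of n] aff_dim_dim_affine_diffs[of "L n" "J n"]
      by (auto simp: V_def orth_affine_subspaces_def inner_commute)
  qed (use assms(1) F(2) \<xi>(1,3) V Q tendsto_mono[OF F(1)] in blast)+
  then show False using no_flat by blast
qed

context smooth_on_open
begin

lemma jet_form_add: "jet_form h x (vs @ (u + w) # ws) = jet_form h x (vs @ u # ws) + jet_form h x (vs @ w # ws)"
  by (simp add: jet_form_eq_multi_form multi_form_add)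

lemma jet_form_scaleR: "jet_form h x (vs @ (a *\<^sub>R u) # ws) = a * jet_form h x (vs @ u # ws)"
  by (simp add: jet_form_eq_multi_form multi_form_scaleR)

lemma jet_form_scaleR_replicate:
  "jet_form h x (vs @ replicate j (a *\<^sub>R q) @ ws) = a ^ j * jet_form h x (vs @ replicate j q @ ws)"
proof (induction j arbitrary: vs)
  case (Suc j)
  have "jet_form h x (vs @ replicate (Suc j) (a *\<^sub>R q) @ ws) = a * jet_form h x ((vs @ [q]) @ replicate j (a *\<^sub>R q) @ ws)"
    using jet_form_scaleR[of x vs a q] by simp
  then show ?case by (simp only: Suc.IH) (simp add: mult.assoc)
qed simp

end

context flat_sequence
begin

lemma F_nontrivial: "F \<noteq> bot"
  using F by (simp add: ultrafilter_def)

lemma X_in: "X n \<in> A"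
  using cball_sub[of n] \<xi>_pos[of n] by auto

lemma Q_tendsto:
  assumes "0 \<le> r" "r \<le> 1"
  shows "\<exists>q. ((\<lambda>n. Q n r) \<longlongrightarrow> q) F \<and> norm q = r"
proof -
  obtain q where q: "((\<lambda>n. Q n r) \<longlongrightarrow> q) F" "q \<in> sphere 0 r"
    using ultrafilter_tendsto_compact[OF F compact_sphere[of 0 r], of "\<lambda>n. Q n r"] norm_Q[OF assms] by auto
  then show ?thesis by auto
qed

lemma jets_tendsto:
  assumes "list_all2 (\<lambda>f l. (f \<longlongrightarrow> l) F) fs ls"
  shows "((\<lambda>n. jet_form h (X n) (map (\<lambda>f. f n) fs)) \<longlongrightarrow> jet_form h x ls) F"
  using x X assms by (rule jet_form_tendsto)

text \<open>Taylor's formula at \<open>X n\<close> with displacement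
  \<open>\<xi> n *\<^sub>R Q n r\<close>. The zeroth term vanishes because \<open>W n\<close> is
  orthogonal to the gradient. After division by the fourth power of \<xi>, the remainder is \<xi>
  times a convergent factor and the gradient term is at most
  \<open>\<epsilon> n * norm (W n)\<close>.\<close>

lemma Taylor_small:
  assumes r: "0 \<le> r" "r \<le> 1" and q: "((\<lambda>n. Q n r) \<longlongrightarrow> q) F"
    and W: "\<And>n. W n \<in> V n" "(W \<longlongrightarrow> w) F"
  shows "((\<lambda>n. (jet_form h (X n) [Q n r, W n] + \<xi> n / 2 * jet_form h (X n) [Q n r, Q n r, W n]
      + \<xi> n ^ 2 / 6 * jet_form h (X n) [Q n r, Q n r, Q n r, W n]
      + \<xi> n ^ 3 / 24 * jet_form h (X n) [Q n r, Q n r, Q n r, Q n r, W n]) / \<xi> n ^ 3) \<longlongrightarrow> 0) F"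
    (is "((\<lambda>n. ?S n / \<xi> n ^ 3) \<longlongrightarrow> 0) F")
proof -
  have "\<exists>t. 0 < t \<and> t < 1 \<and> grad h (X n + \<xi> n *\<^sub>R Q n r) \<bullet> W n = \<xi> n * ?S n +
      \<xi> n ^ 5 * jet_form h (X n + t *\<^sub>R \<xi> n *\<^sub>R Q n r) [Q n r, Q n r, Q n r, Q n r, Q n r, W n] / 120" for n
  proof -
    have "X n + t *\<^sub>R \<xi> n *\<^sub>R Q n r \<in> A" if "0 \<le> t" "t \<le> 1" for t
    proof -
      have "dist (X n) (X n + t *\<^sub>R \<xi> n *\<^sub>R Q n r) \<le> 1 * (\<xi> n * 1)"
        using that r \<xi>_pos[of n] by (auto simp: dist_norm norm_Q intro!: mult_le_one)
      then show ?thesis using cball_sub[of n] by auto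
    qed
    from jet_form_Taylor[OF this, of 5 "W n"] obtain t where t: "0 < t" "t < 1" and
      eq: "jet_form h (X n + \<xi> n *\<^sub>R Q n r) [W n] =
        (\<Sum>j<5. jet_form h (X n) (replicate j (\<xi> n *\<^sub>R Q n r) @ [W n]) / fact j)
        + jet_form h (X n + t *\<^sub>R \<xi> n *\<^sub>R Q n r) (replicate 5 (\<xi> n *\<^sub>R Q n r) @ [W n]) / fact 5"
      by auto
    have sc: "jet_form h y (replicate j (a *\<^sub>R q) @ ws) = a ^ j * jet_form h y (replicate j q @ ws)" for y j a q ws
      using jet_form_scaleR_replicate[of y "[]"] by simp
    have "jet_form h (X n) [W n] = 0" using V_orth[OF W(1)] by (simp add: jet_form_1)
    then show ?thesis using t eq unfolding sc jet_form_1
      by (intro exI[of _ t]) (simp add: jet_form_1 eval_nat_numeral fact_numeral algebra_simps)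
  qed
  then obtain t where t: "\<And>n. 0 < t n" "\<And>n. t n < 1" and
    eq: "\<And>n. grad h (X n + \<xi> n *\<^sub>R Q n r) \<bullet> W n = \<xi> n * ?S n +
      \<xi> n ^ 5 * jet_form h (X n + t n *\<^sub>R \<xi> n *\<^sub>R Q n r) [Q n r, Q n r, Q n r, Q n r, Q n r, W n] / 120"
    by metis
  let ?R = "\<lambda>n. jet_form h (X n + t n *\<^sub>R \<xi> n *\<^sub>R Q n r) [Q n r, Q n r, Q n r, Q n r, Q n r, W n]"
  have "((\<lambda>n. t n *\<^sub>R \<xi> n *\<^sub>R Q n r) \<longlongrightarrow> 0) F"
  proof (rule tendsto_0_le[OF \<xi>])
    show "\<forall>\<^sub>F n in F. norm (t n *\<^sub>R \<xi> n *\<^sub>R Q n r) \<le> norm (\<xi> n) * 1"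
      using t r \<xi>_pos by (auto simp: norm_Q less_imp_le intro!: always_eventually mult_le_one mult_left_le_one_le mult_left_le)
  qed
  then have "((\<lambda>n. X n + t n *\<^sub>R \<xi> n *\<^sub>R Q n r) \<longlongrightarrow> x) F"
    using tendsto_add[OF X] by force
  then have "((\<lambda>n. jet_form h (X n + t n *\<^sub>R \<xi> n *\<^sub>R Q n r) (map (\<lambda>f. f n)
      [\<lambda>n. Q n r, \<lambda>n. Q n r, \<lambda>n. Q n r, \<lambda>n. Q n r, \<lambda>n. Q n r, W])) \<longlongrightarrow> jet_form h x [q, q, q, q, q, w]) F"
    by (rule jet_form_tendsto[OF x]) (simp add: q W)
  then have "(?R \<longlongrightarrow> jet_form h x [q, q, q, q, q, w]) F" by simp
  then have R0: "((\<lambda>n. \<xi> n * ?R n / 120) \<longlongrightarrow> 0 * jet_form h x [q, q, q, q, q, w] / 120) F"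
    by (intro tendsto_intros \<xi>) auto
  have G0: "((\<lambda>n. (grad h (X n + \<xi> n *\<^sub>R Q n r) \<bullet> W n) / \<xi> n ^ 4) \<longlongrightarrow> 0) F"
  proof (rule tendsto_0_le)
    show "((\<lambda>n. \<epsilon> n * norm (W n)) \<longlongrightarrow> 0) F"
      using tendsto_mult[OF \<epsilon> tendsto_norm[OF W(2)]] by simp
    show "\<forall>\<^sub>F n in F. norm (grad h (X n + \<xi> n *\<^sub>R Q n r) \<bullet> W n / \<xi> n ^ 4) \<le> norm (\<epsilon> n * norm (W n)) * 1"
    proof (rule always_eventually, rule allI)
      fix n
      have "\<bar>grad h (X n + \<xi> n *\<^sub>R Q n r) \<bullet> W n\<bar> \<le> \<epsilon> n * \<xi> n ^ 4 * norm (W n)"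
        using grad_small[OF r W(1)] .
      then have "\<bar>grad h (X n + \<xi> n *\<^sub>R Q n r) \<bullet> W n\<bar> / \<xi> n ^ 4 \<le> \<epsilon> n * norm (W n)"
        using \<xi>_pos[of n] by (simp add: divide_le_eq mult_ac)
      then show "norm (grad h (X n + \<xi> n *\<^sub>R Q n r) \<bullet> W n / \<xi> n ^ 4) \<le> norm (\<epsilon> n * norm (W n)) * 1"
        using \<xi>_pos[of n] by simp
    qed
  qed
  have "?S n / \<xi> n ^ 3 = (grad h (X n + \<xi> n *\<^sub>R Q n r) \<bullet> W n) / \<xi> n ^ 4 - \<xi> n * ?R n / 120" for n
  proof -
    have "(grad h (X n + \<xi> n *\<^sub>R Q n r) \<bullet> W n) / \<xi> n ^ 4 = \<xi> n * ?S n / \<xi> n ^ 4 + \<xi> n ^ 5 * ?R n / 120 / \<xi> n ^ 4"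
      unfolding eq by (rule add_divide_distrib)
    moreover have "\<xi> n * ?S n / \<xi> n ^ 4 = ?S n / \<xi> n ^ 3" "\<xi> n ^ 5 * ?R n / 120 / \<xi> n ^ 4 = \<xi> n * ?R n / 120"
      using \<xi>_pos[of n] by (simp_all add: eval_nat_numeral)
    ultimately show ?thesis by simp
  qed
  then show ?thesis using tendsto_diff[OF G0 R0] by simp
qed

end

lemma orthonormal_1_expansion:
  fixes v :: "'a::euclidean_space"
  assumes "dim V = 1" "v \<in> V" "norm v = 1" "p \<in> V"
  shows "p = (p \<bullet> v) *\<^sub>R v"
proof -
  have "v \<noteq> 0" using assms(3) by auto
  then have "independent {v}" by simp
  then have "V \<subseteq> span {v}" using assms by (intro card_ge_dim_independent) auto
  then obtain k where k: "p = k *\<^sub>R v" using assms(4) by (auto simp: span_singleton)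
  have "p \<bullet> v = k" using assms(3) by (simp add: k dot_square_norm)
  then show ?thesis using k by simp
qed

lemma orthonormal_2_expansion:
  fixes u v :: "'a::euclidean_space"
  assumes "dim V = 2" "u \<in> V" "v \<in> V" "norm u = 1" "norm v = 1" "u \<bullet> v = 0" "p \<in> V"
  shows "p = (p \<bullet> v) *\<^sub>R v + (p \<bullet> u) *\<^sub>R u"
proof -
  have nz: "u \<noteq> 0" "v \<noteq> 0" using assms by auto
  then have "u \<noteq> v" using assms(6) by auto
  have "independent {u, v}"
    using assms(6) nz by (intro pairwise_orthogonal_independent)
      (auto simp: pairwise_def orthogonal_def inner_commute)
  then have "V \<subseteq> span {u, v}" using assms \<open>u \<noteq> v\<close> by (intro card_ge_dim_independent) auto
  then have "p \<in> span {u, v}" using assms(7) by blast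
  then obtain l where "p - l *\<^sub>R u \<in> span {v}" by (auto simp: span_breakdown_eq)
  then obtain k where "p - l *\<^sub>R u = k *\<^sub>R v" by (auto simp: span_singleton)
  then have p: "p = k *\<^sub>R v + l *\<^sub>R u" by (simp add: algebra_simps)
  have "p \<bullet> v = k" "p \<bullet> u = l"
    using assms(4-6) by (simp_all add: p inner_add_left dot_square_norm inner_commute[of v u])
  then show ?thesis using p by simp
qed

lemma ex_zero_on_circle:
  fixes f :: "real \<Rightarrow> real \<Rightarrow> real"
  assumes "continuous_on UNIV (\<lambda>(x, y). f x y)" "\<And>x y. f (- x) (- y) = - f x y"
  shows "\<exists>\<theta>. f (cos \<theta>) (sin \<theta>) = 0"
proof (rule ex_zero_antisymmetric_endpoints[where a = 0 and b = pi])
  have "continuous_on {0..pi} ((\<lambda>(x, y). f x y) \<circ> (\<lambda>\<theta>. (cos \<theta>, sin \<theta>)))"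
    by (intro continuous_on_compose continuous_on_subset[OF assms(1)] continuous_intros) auto
  then show "continuous_on {0..pi} (\<lambda>\<theta>. f (cos \<theta>) (sin \<theta>))" by (simp add: o_def)
  show "f (cos pi) (sin pi) = - f (cos 0) (sin 0)" using assms(2)[of 1 0] by simp
qed simp

context smooth_on_open
begin

lemma jet_form_2_linear:
  "jet_form h x [p + q, w] = jet_form h x [p, w] + jet_form h x [q, w]"
  "jet_form h x [p, q + w] = jet_form h x [p, q] + jet_form h x [p, w]"
  "jet_form h x [a *\<^sub>R p, w] = a * jet_form h x [p, w]"
  "jet_form h x [p, a *\<^sub>R w] = a * jet_form h x [p, w]"
  using jet_form_add[of x "[]" p q "[w]"] jet_form_add[of x "[p]" q w "[]"]
    jet_form_scaleR[of x "[]" a p "[w]"] jet_form_scaleR[of x "[p]" a w "[]"]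
  by simp_all

lemma jet_form_3_linear:
  "jet_form h x [p + p', q, w] = jet_form h x [p, q, w] + jet_form h x [p', q, w]"
  "jet_form h x [p, q + q', w] = jet_form h x [p, q, w] + jet_form h x [p, q', w]"
  "jet_form h x [p, q, w + w'] = jet_form h x [p, q, w] + jet_form h x [p, q, w']"
  "jet_form h x [a *\<^sub>R p, q, w] = a * jet_form h x [p, q, w]"
  "jet_form h x [p, a *\<^sub>R q, w] = a * jet_form h x [p, q, w]"
  "jet_form h x [p, q, a *\<^sub>R w] = a * jet_form h x [p, q, w]"
  using jet_form_add[of x "[]" p p' "[q, w]"] jet_form_add[of x "[p]" q q' "[w]"]
    jet_form_add[of x "[p, q]" w w' "[]"]
    jet_form_scaleR[of x "[]" a p "[q, w]"] jet_form_scaleR[of x "[p]" a q "[w]"]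
    jet_form_scaleR[of x "[p, q]" a w "[]"]
  by simp_all

lemma jet_form_2_commute: "x \<in> A \<Longrightarrow> jet_form h x [p, q] = jet_form h x [q, p]"
  by (rule jet_form_mset) auto

lemma jet_form_scaleR_front:
  "jet_form h x [a *\<^sub>R q, w] = a * jet_form h x [q, w]"
  "jet_form h x [a *\<^sub>R q, a *\<^sub>R q, w] = a ^ 2 * jet_form h x [q, q, w]"
  "jet_form h x [a *\<^sub>R q, a *\<^sub>R q, a *\<^sub>R q, w] = a ^ 3 * jet_form h x [q, q, q, w]"
  "jet_form h x [a *\<^sub>R q, a *\<^sub>R q, a *\<^sub>R q, a *\<^sub>R q, w] = a ^ 4 * jet_form h x [q, q, q, q, w]"
  using jet_form_scaleR_replicate[of x "[]" 1 a q "[w]"] jet_form_scaleR_replicate[of x "[]" 2 a q "[w]"]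
    jet_form_scaleR_replicate[of x "[]" 3 a q "[w]"] jet_form_scaleR_replicate[of x "[]" 4 a q "[w]"]
  by (simp_all add: numeral_eq_Suc)

lemma ex_zero_cubic_form:
  "\<exists>\<theta>. let p = cos \<theta> *\<^sub>R v + sin \<theta> *\<^sub>R u in jet_form h x [p, p, p] = 0"
  unfolding Let_def
proof (rule ex_zero_on_circle)
  let ?f = "\<lambda>a b. jet_form h x [a *\<^sub>R v + b *\<^sub>R u, a *\<^sub>R v + b *\<^sub>R u, a *\<^sub>R v + b *\<^sub>R u]"
  show "continuous_on UNIV (\<lambda>(a, b). ?f a b)"
    unfolding jet_form_3_linear case_prod_unfold by (intro continuous_intros)
  show "?f (- a) (- b) = - ?f a b" for a b
    unfolding jet_form_3_linear by (simp add: algebra_simps)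
qed

end

section \<open>Flat sequences on lines and on hyperplanes\<close>

context flat_sequence
begin

lemma grad_tendsto: "((\<lambda>n. grad h (X n)) \<longlongrightarrow> grad h x) F"
  using isCont_grad[OF x] X by (rule isCont_tendsto_compose)

lemma limit_orth:
  assumes "\<And>n. W n \<in> V n" "(W \<longlongrightarrow> w) F"
  shows "grad h x \<bullet> w = 0"
proof -
  have "((\<lambda>n. grad h (X n) \<bullet> W n) \<longlongrightarrow> grad h x \<bullet> w) F"
    using grad_tendsto assms(2) by (rule tendsto_inner)
  then have "((\<lambda>n. 0 :: real) \<longlongrightarrow> grad h x \<bullet> w) F" using V_orth[OF assms(1)] by simp
  then show ?thesis by (simp add: tendsto_const_iff F_nontrivial)
qed

lemma unit_tendsto:
  fixes W :: "nat \<Rightarrow> real^'n"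
  assumes "\<And>n. norm (W n) = 1"
  shows "\<exists>w. (W \<longlongrightarrow> w) F \<and> norm w = 1"
proof -
  obtain w where "(W \<longlongrightarrow> w) F" "w \<in> sphere 0 1"
    using ultrafilter_tendsto_compact[OF F compact_sphere[of 0 1], of W] assms by auto
  then show ?thesis by auto
qed

text \<open>On a line every \<open>Q n r\<close> is a multiple of the unit vector
  \<open>Q n 1\<close> with factor of modulus \<open>r\<close>, so the Taylor expression is a
  polynomial in that factor and \<open>poly_coeffs_tendsto_0\<close> applies.\<close>

lemma flat_direction:
  assumes "m = 1"
  shows "\<exists>v. norm v = 1 \<and> jet_form h x [v] = 0 \<and> jet_form h x [v, v] = 0 \<and> jet_form h x [v, v, v] = 0
    \<and> jet_form h x [v, v, v, v] = 0 \<and> jet_form h x [v, v, v, v, v] = 0"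
proof -
  define v where "v n = Q n 1" for n
  have v: "v n \<in> V n" "norm (v n) = 1" for n by (simp_all add: v_def Q_in norm_Q)
  obtain w where w: "(v \<longlongrightarrow> w) F" "norm w = 1" using unit_tendsto v(2) by blast
  let ?J = "\<lambda>k n. jet_form h (X n) (replicate k (v n))"
  \<comment> \<open>The zero in front aligns list positions with powers: position \<open>j\<close>
    carries the jet of order \<open>j + 1\<close>.\<close>
  define c where "c = (\<lambda>j n. [0, ?J 2 n / \<xi> n ^ 3, ?J 3 n / (2 * \<xi> n ^ 2), ?J 4 n / (6 * \<xi> n), ?J 5 n / 24] ! j)"
  have c0: "(c i \<longlongrightarrow> 0) F" if "i \<le> 4" for i
  proof (rule poly_coeffs_tendsto_0[OF F _ that])
    fix r :: real assume r: "0 \<le> r" "r \<le> 1"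
    obtain q where q: "((\<lambda>n. Q n r) \<longlongrightarrow> q) F" "norm q = r" using Q_tendsto[OF r] by blast
    define s where "s n = Q n r \<bullet> v n" for n
    have Qs: "Q n r = s n *\<^sub>R v n" for n
      unfolding s_def using orthonormal_1_expansion[of "V n"] dim_V assms v Q_in[OF r] by metis
    have "(s \<longlongrightarrow> q \<bullet> w) F" unfolding s_def by (intro tendsto_inner q w)
    moreover have "\<bar>q \<bullet> w\<bar> = r"
    proof -
      have "((\<lambda>n. \<bar>s n\<bar>) \<longlongrightarrow> \<bar>q \<bullet> w\<bar>) F" using calculation by (rule tendsto_rabs)
      moreover have "\<bar>s n\<bar> = r" for n using norm_Q[OF r, of n] v(2)[of n] by (simp add: Qs)
      ultimately show ?thesis by (simp add: tendsto_const_iff F_nontrivial)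
    qed
    moreover have "((\<lambda>n. \<Sum>j\<le>4. c j n * s n ^ j) \<longlongrightarrow> 0) F"
    proof -
      have "(\<Sum>j\<le>4. c j n * s n ^ j) = (jet_form h (X n) [Q n r, v n] + \<xi> n / 2 * jet_form h (X n) [Q n r, Q n r, v n]
        + \<xi> n ^ 2 / 6 * jet_form h (X n) [Q n r, Q n r, Q n r, v n]
        + \<xi> n ^ 3 / 24 * jet_form h (X n) [Q n r, Q n r, Q n r, Q n r, v n]) / \<xi> n ^ 3" for n
        unfolding Qs jet_form_scaleR_front using \<xi>_pos[of n]
        by (simp add: c_def numeral_eq_Suc field_simps)
      then show ?thesis using Taylor_small[OF r q(1) v(1) w(1)] by simp
    qed
    ultimately show "\<exists>s l. (s \<longlongrightarrow> l) F \<and> \<bar>l\<bar> = r \<and> ((\<lambda>n. \<Sum>j\<le>4. c j n * s n ^ j) \<longlongrightarrow> 0) F"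
      by blast
  qed
  have J: "(?J k \<longlongrightarrow> jet_form h x (replicate k w)) F" for k
    using jets_tendsto[of "replicate k v" "replicate k w"] w(1)
    by (simp add: list_all2_conv_all_nth)
  have "jet_form h x (replicate k w) = 0" if "k \<in> {2..5}" for k
  proof -
    \<comment> \<open>Multiplying back the factorial and the power of \<xi> recovers the jet of
      order \<open>k\<close>; a vanishing coefficient thus gives a vanishing jet.\<close>
    have "((\<lambda>n. c (k - 1) n * (fact (k - 1) * \<xi> n ^ (5 - k))) \<longlongrightarrow> 0 * (fact (k - 1) * 0 ^ (5 - k))) F"
      using that by (intro tendsto_intros c0 \<xi>) auto
    moreover have "c (k - 1) n * (fact (k - 1) * \<xi> n ^ (5 - k)) = ?J k n" for n
    proof -
      have "k = 2 \<or> k = 3 \<or> k = 4 \<or> k = 5" using that by auto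
      then show ?thesis using \<xi>_pos[of n] by (auto simp: c_def eval_nat_numeral)
    qed
    ultimately have "(?J k \<longlongrightarrow> 0) F" by simp
    then show ?thesis by (rule tendsto_unique[OF F_nontrivial J])
  qed
  from this[of 2] this[of 3] this[of 4] this[of 5] show ?thesis
    using w limit_orth[OF v(1) w(1)] by (intro exI[of _ w]) (simp add: numeral_eq_Suc jet_form_1)
qed

lemma flat_hyperplane:
  assumes "m = CARD('n) - 1" "grad h x \<noteq> 0"
  shows "\<exists>v. v \<noteq> 0 \<and> jet_form h x [v] = 0 \<and> jet_form h x [v, v, v] = 0
    \<and> (\<forall>w. jet_form h x [w] = 0 \<longrightarrow> jet_form h x [v, w] = 0)"
proof -
  let ?g = "\<lambda>n. grad h (X n)"
  \<comment> \<open>At leading order the Taylor expression is the Hessian term alone. Since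
    \<open>V n\<close> is the whole orthogonal complement of the gradient, any \<open>w\<close>
    orthogonal to the limit gradient may serve as test vector.\<close>
  have ker: "jet_form h x [q, w] = 0"
    if r: "0 \<le> r" "r \<le> 1" and q: "((\<lambda>n. Q n r) \<longlongrightarrow> q) F" and w: "grad h x \<bullet> w = 0" for r q w
  proof -
    \<comment> \<open>\<open>w\<close> is projected onto the complement of the moving gradient. The
      default 0 keeps \<open>W n\<close> in \<open>V n\<close> for all \<open>n\<close>; eventually
      the gradient is nonzero.\<close>
    define W where "W n = (if ?g n = 0 then 0 else w - (w \<bullet> ?g n / (?g n \<bullet> ?g n)) *\<^sub>R ?g n)" for n
    have W: "W n \<in> V n" for n
    proof (cases "?g n = 0")
      case True
      then show ?thesis using subspace_0[OF subspace_V] by (simp add: W_def)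
    next
      case False
      have "V n \<subseteq> {w. ?g n \<bullet> w = 0}" using V_orth by blast
      moreover have "dim {w. ?g n \<bullet> w = 0} \<le> dim (V n)"
        using dim_hyperplane[OF False] dim_V assms(1) by simp
      ultimately have "V n = {w. ?g n \<bullet> w = 0}"
        by (intro subspace_dim_equal subspace_V subspace_hyperplane)
      moreover have "?g n \<bullet> W n = 0" using False by (simp add: W_def inner_diff_right inner_commute)
      ultimately show ?thesis by blast
    qed
    have "((\<lambda>n. w - (w \<bullet> ?g n / (?g n \<bullet> ?g n)) *\<^sub>R ?g n) \<longlongrightarrow> w - (w \<bullet> grad h x / (grad h x \<bullet> grad h x)) *\<^sub>R grad h x) F"
      using assms(2) by (intro tendsto_intros grad_tendsto) auto
    then have "((\<lambda>n. w - (w \<bullet> ?g n / (?g n \<bullet> ?g n)) *\<^sub>R ?g n) \<longlongrightarrow> w) F"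
      using w by (simp add: inner_commute)
    moreover have "eventually (\<lambda>n. w - (w \<bullet> ?g n / (?g n \<bullet> ?g n)) *\<^sub>R ?g n = W n) F"
      using tendsto_imp_eventually_ne[OF grad_tendsto assms(2)] by eventually_elim (simp add: W_def)
    ultimately have Ww: "(W \<longlongrightarrow> w) F" by (rule Lim_transform_eventually)
    have J2: "((\<lambda>n. jet_form h (X n) [Q n r, W n]) \<longlongrightarrow> jet_form h x [q, w]) F"
      using jets_tendsto[of "[\<lambda>n. Q n r, W]" "[q, w]"] q Ww by simp
    have J3: "((\<lambda>n. jet_form h (X n) [Q n r, Q n r, W n]) \<longlongrightarrow> jet_form h x [q, q, w]) F"
      using jets_tendsto[of "[\<lambda>n. Q n r, \<lambda>n. Q n r, W]" "[q, q, w]"] q Ww by simp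
    have J4: "((\<lambda>n. jet_form h (X n) [Q n r, Q n r, Q n r, W n]) \<longlongrightarrow> jet_form h x [q, q, q, w]) F"
      using jets_tendsto[of "[\<lambda>n. Q n r, \<lambda>n. Q n r, \<lambda>n. Q n r, W]" "[q, q, q, w]"] q Ww by simp
    have J5: "((\<lambda>n. jet_form h (X n) [Q n r, Q n r, Q n r, Q n r, W n]) \<longlongrightarrow> jet_form h x [q, q, q, q, w]) F"
      using jets_tendsto[of "[\<lambda>n. Q n r, \<lambda>n. Q n r, \<lambda>n. Q n r, \<lambda>n. Q n r, W]" "[q, q, q, q, w]"] q Ww by simp
    let ?E = "\<lambda>n. (jet_form h (X n) [Q n r, W n] + \<xi> n / 2 * jet_form h (X n) [Q n r, Q n r, W n]
        + \<xi> n ^ 2 / 6 * jet_form h (X n) [Q n r, Q n r, Q n r, W n]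
        + \<xi> n ^ 3 / 24 * jet_form h (X n) [Q n r, Q n r, Q n r, Q n r, W n]) / \<xi> n ^ 3"
    have "((\<lambda>n. ?E n * \<xi> n ^ 3) \<longlongrightarrow> 0 * 0 ^ 3) F"
      by (intro tendsto_intros Taylor_small[OF r q W Ww] \<xi>)
    moreover have "((\<lambda>n. ?E n * \<xi> n ^ 3) \<longlongrightarrow> jet_form h x [q, w] + 0 / 2 * jet_form h x [q, q, w]
        + 0 ^ 2 / 6 * jet_form h x [q, q, q, w] + 0 ^ 3 / 24 * jet_form h x [q, q, q, q, w]) F"
    proof -
      have "?E n * \<xi> n ^ 3 = jet_form h (X n) [Q n r, W n] + \<xi> n / 2 * jet_form h (X n) [Q n r, Q n r, W n]
        + \<xi> n ^ 2 / 6 * jet_form h (X n) [Q n r, Q n r, Q n r, W n]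
        + \<xi> n ^ 3 / 24 * jet_form h (X n) [Q n r, Q n r, Q n r, Q n r, W n]" for n
        using \<xi>_pos[of n] by simp
      then show ?thesis by (simp only:) (intro tendsto_intros J2 J3 J4 J5 \<xi>; simp)
    qed
    ultimately show ?thesis using tendsto_unique[OF F_nontrivial] by fastforce
  qed
  obtain q where q: "((\<lambda>n. Q n 1) \<longlongrightarrow> q) F" "norm q = 1" using Q_tendsto[of 1] by auto
  obtain p where p: "((\<lambda>n. Q n (1/2)) \<longlongrightarrow> p) F" "norm p = 1/2" using Q_tendsto[of "1/2"] by auto
  have orth: "grad h x \<bullet> q = 0" "grad h x \<bullet> p = 0"
    by (rule limit_orth[OF _ q(1)], simp add: Q_in, rule limit_orth[OF _ p(1)], simp add: Q_in)
  have kq: "jet_form h x [q, w] = 0" "jet_form h x [p, w] = 0" if "grad h x \<bullet> w = 0" for w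
    using ker[OF _ _ q(1) that] ker[OF _ _ p(1) that] by auto
  let ?V = "\<lambda>v. v \<noteq> 0 \<and> jet_form h x [v] = 0 \<and> jet_form h x [v, v, v] = 0
    \<and> (\<forall>w. jet_form h x [w] = 0 \<longrightarrow> jet_form h x [v, w] = 0)"
  show ?thesis
  proof (cases "\<exists>k. p = k *\<^sub>R q")
    case True
    then obtain k where k: "p = k *\<^sub>R q" by blast
    have "\<bar>k\<bar> = 1/2" using p(2) q(2) by (simp add: k)
    \<comment> \<open>Test the equation at radius 1 with the point of radius 1/2 and vice versa. The
      Hessian terms cancel in the difference by symmetry, leaving the cubic terms at leading
      order.\<close>
    have "jet_form h x [q, q, p] = jet_form h x [p, p, q]"
    proof -
      let ?q = "\<lambda>n. Q n 1" and ?p = "\<lambda>n. Q n (1/2)"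
      let ?E = "\<lambda>n. (jet_form h (X n) [?q n, ?p n] + \<xi> n / 2 * jet_form h (X n) [?q n, ?q n, ?p n]
        + \<xi> n ^ 2 / 6 * jet_form h (X n) [?q n, ?q n, ?q n, ?p n]
        + \<xi> n ^ 3 / 24 * jet_form h (X n) [?q n, ?q n, ?q n, ?q n, ?p n]) / \<xi> n ^ 3"
      let ?E' = "\<lambda>n. (jet_form h (X n) [?p n, ?q n] + \<xi> n / 2 * jet_form h (X n) [?p n, ?p n, ?q n]
        + \<xi> n ^ 2 / 6 * jet_form h (X n) [?p n, ?p n, ?p n, ?q n]
        + \<xi> n ^ 3 / 24 * jet_form h (X n) [?p n, ?p n, ?p n, ?p n, ?q n]) / \<xi> n ^ 3"
      have E: "(?E \<longlongrightarrow> 0) F" "(?E' \<longlongrightarrow> 0) F"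
        using Taylor_small[OF _ _ q(1) _ p(1)] Taylor_small[OF _ _ p(1) _ q(1)] by (simp_all add: Q_in)
      have "((\<lambda>n. (?E n - ?E' n) * \<xi> n ^ 2) \<longlongrightarrow> (0 - 0) * 0 ^ 2) F"
        by (intro tendsto_mult tendsto_diff tendsto_power E \<xi>)
      moreover have "((\<lambda>n. (?E n - ?E' n) * \<xi> n ^ 2) \<longlongrightarrow>
          (jet_form h x [q, q, p] - jet_form h x [p, p, q]) / 2
          + 0 / 6 * (jet_form h x [q, q, q, p] - jet_form h x [p, p, p, q])
          + 0 ^ 2 / 24 * (jet_form h x [q, q, q, q, p] - jet_form h x [p, p, p, p, q])) F"
      proof -
        have eq: "(?E n - ?E' n) * \<xi> n ^ 2 = (jet_form h (X n) [?q n, ?q n, ?p n] - jet_form h (X n) [?p n, ?p n, ?q n]) / 2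
          + \<xi> n / 6 * (jet_form h (X n) [?q n, ?q n, ?q n, ?p n] - jet_form h (X n) [?p n, ?p n, ?p n, ?q n])
          + \<xi> n ^ 2 / 24 * (jet_form h (X n) [?q n, ?q n, ?q n, ?q n, ?p n] - jet_form h (X n) [?p n, ?p n, ?p n, ?p n, ?q n])" for n
          using \<xi>_pos[of n] jet_form_2_commute[OF X_in[of n], of "?p n" "?q n"]
          by (simp add: field_simps eval_nat_numeral)
        have J: "((\<lambda>n. jet_form h (X n) [?q n, ?q n, ?p n]) \<longlongrightarrow> jet_form h x [q, q, p]) F"
          "((\<lambda>n. jet_form h (X n) [?p n, ?p n, ?q n]) \<longlongrightarrow> jet_form h x [p, p, q]) F"
          "((\<lambda>n. jet_form h (X n) [?q n, ?q n, ?q n, ?p n]) \<longlongrightarrow> jet_form h x [q, q, q, p]) F"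
          "((\<lambda>n. jet_form h (X n) [?p n, ?p n, ?p n, ?q n]) \<longlongrightarrow> jet_form h x [p, p, p, q]) F"
          "((\<lambda>n. jet_form h (X n) [?q n, ?q n, ?q n, ?q n, ?p n]) \<longlongrightarrow> jet_form h x [q, q, q, q, p]) F"
          "((\<lambda>n. jet_form h (X n) [?p n, ?p n, ?p n, ?p n, ?q n]) \<longlongrightarrow> jet_form h x [p, p, p, p, q]) F"
          using jets_tendsto[of "[?q, ?q, ?p]" "[q, q, p]"] jets_tendsto[of "[?p, ?p, ?q]" "[p, p, q]"]
            jets_tendsto[of "[?q, ?q, ?q, ?p]" "[q, q, q, p]"] jets_tendsto[of "[?p, ?p, ?p, ?q]" "[p, p, p, q]"]
            jets_tendsto[of "[?q, ?q, ?q, ?q, ?p]" "[q, q, q, q, p]"]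
            jets_tendsto[of "[?p, ?p, ?p, ?p, ?q]" "[p, p, p, p, q]"] p q by simp_all
        show ?thesis unfolding eq by (intro tendsto_intros J \<xi>; simp)
      qed
      ultimately have "(0 - 0) * 0 ^ 2 = (jet_form h x [q, q, p] - jet_form h x [p, p, q]) / 2
          + 0 / 6 * (jet_form h x [q, q, q, p] - jet_form h x [p, p, p, q])
          + 0 ^ 2 / 24 * (jet_form h x [q, q, q, q, p] - jet_form h x [p, p, p, p, q])"
        by (rule tendsto_unique[OF F_nontrivial])
      then show ?thesis by simp
    qed
    \<comment> \<open>The radii 1 and 1/2 give \<open>k\<close> the modulus 1/2, so \<open>k\<close>
      is neither 0 nor 1.\<close>
    then have "k * (1 - k) * jet_form h x [q, q, q] = 0"
      unfolding k jet_form_3_linear by (simp add: algebra_simps)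
    then have "jet_form h x [q, q, q] = 0" using \<open>\<bar>k\<bar> = 1/2\<close> by auto
    then have "?V q" using q(2) orth(1) kq(1) by (auto simp: jet_form_1)
    then show ?thesis by blast
  next
    case False
    obtain \<theta> where \<theta>: "jet_form h x [cos \<theta> *\<^sub>R q + sin \<theta> *\<^sub>R p, cos \<theta> *\<^sub>R q + sin \<theta> *\<^sub>R p, cos \<theta> *\<^sub>R q + sin \<theta> *\<^sub>R p] = 0"
      using ex_zero_cubic_form[of q p x] unfolding Let_def by blast
    define v where "v = cos \<theta> *\<^sub>R q + sin \<theta> *\<^sub>R p"
    have "v \<noteq> 0"
    proof
      assume v0: "v = 0"
      show False
      proof (cases "sin \<theta> = 0")
        case True
        then have "cos \<theta> \<noteq> 0" using sin_cos_squared_add[of \<theta>] by auto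
        then show False using v0 True q(2) by (auto simp: v_def)
      next
        case False
        have "sin \<theta> *\<^sub>R p = - cos \<theta> *\<^sub>R q" using v0 by (simp add: v_def eq_neg_iff_add_eq_0 add.commute)
        then have "(1 / sin \<theta>) *\<^sub>R sin \<theta> *\<^sub>R p = (1 / sin \<theta>) *\<^sub>R - cos \<theta> *\<^sub>R q" by (rule arg_cong)
        then have "p = (- cos \<theta> / sin \<theta>) *\<^sub>R q" using False by simp
        then show False using \<open>\<nexists>k. p = k *\<^sub>R q\<close> by blast
      qed
    qed
    moreover have "grad h x \<bullet> v = 0" using orth by (simp add: v_def inner_add_right)
    moreover have "jet_form h x [v, w] = 0" if "grad h x \<bullet> w = 0" for w
      using kq[OF that] by (simp add: v_def jet_form_2_linear)
    ultimately have "?V v" using \<theta> by (simp add: jet_form_1 v_def)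
    then show ?thesis by blast
  qed
qed

end

subsection \<open>Flat points on planes\<close>

context smooth_on_open
begin

text \<open>Rotate an orthonormal basis. A quarter turn reverses the sign of the off-diagonal entry,
  so it vanishes at some angle; finally the two vectors are ordered by the size of the diagonal
  entries.\<close>

lemma diagonalizing_frame:
  assumes x: "x \<in> A" and V: "subspace V" "dim V = 2"
  shows "\<exists>u v. u \<in> V \<and> v \<in> V \<and> norm u = 1 \<and> norm v = 1 \<and> u \<bullet> v = 0 \<and> jet_form h x [u, v] = 0
    \<and> \<bar>jet_form h x [v, v]\<bar> \<le> \<bar>jet_form h x [u, u]\<bar>"
proof -
  obtain B where B: "B \<subseteq> V" "pairwise orthogonal B" "\<And>y. y \<in> B \<Longrightarrow> norm y = 1" "card B = dim V"
    using orthonormal_basis_subspace[OF V(1)] by metis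
  then obtain e f where ef: "B = {e, f}" "e \<noteq> f" using V(2) card_2_iff[of B] by auto
  then have e: "e \<in> V" "f \<in> V" "norm e = 1" "norm f = 1" "e \<bullet> f = 0"
    using B by (auto simp: pairwise_def orthogonal_def)
  define p where "p \<theta> = cos \<theta> *\<^sub>R e + sin \<theta> *\<^sub>R f" for \<theta>
  define q where "q \<theta> = (- sin \<theta>) *\<^sub>R e + cos \<theta> *\<^sub>R f" for \<theta>
  have "\<exists>\<theta>. jet_form h x [p \<theta>, q \<theta>] = 0"
  proof (rule ex_zero_antisymmetric_endpoints[where a = 0 and b = "pi / 2"])
    show "continuous_on {0..pi / 2} (\<lambda>\<theta>. jet_form h x [p \<theta>, q \<theta>])"
      unfolding p_def q_def jet_form_2_linear by (intro continuous_intros)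
    show "jet_form h x [p (pi / 2), q (pi / 2)] = - jet_form h x [p 0, q 0]"
      using jet_form_2_commute[OF x, of e f] jet_form_2_linear(4)[of x f "- 1" e] by (simp add: p_def q_def)
  qed simp
  then obtain \<theta> where \<theta>: "jet_form h x [p \<theta>, q \<theta>] = 0" by blast
  have in_V: "p \<theta> \<in> V" "q \<theta> \<in> V" unfolding p_def q_def
    by (intro subspace_add[OF V(1)] subspace_scale[OF V(1)] e(1,2))+
  have ee: "e \<bullet> e = 1" "f \<bullet> f = 1" using e by (simp_all add: dot_square_norm)
  have orth: "p \<theta> \<bullet> q \<theta> = 0"
    using e by (simp add: p_def q_def inner_add_left inner_add_right inner_diff_left inner_diff_right ee inner_commute[of f e])
  have "p \<theta> \<bullet> p \<theta> = 1" "q \<theta> \<bullet> q \<theta> = 1"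
    using e sin_cos_squared_add[of \<theta>]
    by (simp_all add: p_def q_def inner_add_left inner_add_right inner_diff_left inner_diff_right ee inner_commute[of f e] power2_eq_square)
  then have norm: "norm (p \<theta>) = 1" "norm (q \<theta>) = 1" by (simp_all add: norm_eq_1)
  show ?thesis
  proof (cases "\<bar>jet_form h x [q \<theta>, q \<theta>]\<bar> \<le> \<bar>jet_form h x [p \<theta>, p \<theta>]\<bar>")
    case True
    then show ?thesis using in_V orth norm \<theta> by blast
  next
    case False
    then have "\<bar>jet_form h x [p \<theta>, p \<theta>]\<bar> \<le> \<bar>jet_form h x [q \<theta>, q \<theta>]\<bar>" by simp
    then show ?thesis using in_V orth norm \<theta> jet_form_2_commute[OF x, of "p \<theta>"] inner_commute[of "p \<theta>"]
      by metis
  qed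
qed

end

text \<open>Moving orthonormal frames of the planes together with their limits. By
  \<open>le\<close>, control of the Hessian entry along \<open>u\<close> also controls the one along
  \<open>v\<close>.\<close>

locale flat_plane_sequence = flat_sequence A h m x X V \<xi> \<epsilon> Q F
  for A :: "(real^'n::finite) set" and h m x X V \<xi> \<epsilon> Q F +
  fixes u v :: "nat \<Rightarrow> real^'n" and u' v' :: "real^'n"
  assumes m: "m = 2"
    and u_in: "\<And>n. u n \<in> V n" and v_in: "\<And>n. v n \<in> V n"
    and norm_u: "\<And>n. norm (u n) = 1" and norm_v: "\<And>n. norm (v n) = 1"
    and orth: "\<And>n. u n \<bullet> v n = 0"
    and diag: "\<And>n. jet_form h (X n) [u n, v n] = 0"
    and le: "\<And>n. \<bar>jet_form h (X n) [v n, v n]\<bar> \<le> \<bar>jet_form h (X n) [u n, u n]\<bar>"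
    and u_lim: "(u \<longlongrightarrow> u') F" and v_lim: "(v \<longlongrightarrow> v') F"

lemma (in flat_sequence) ex_flat_plane_sequence:
  assumes "m = 2"
  shows "\<exists>u v u' v'. flat_plane_sequence A h m x X V \<xi> \<epsilon> Q F u v u' v'"
proof -
  have "\<forall>n. \<exists>u v. u \<in> V n \<and> v \<in> V n \<and> norm u = 1 \<and> norm v = 1 \<and> u \<bullet> v = 0 \<and> jet_form h (X n) [u, v] = 0
    \<and> \<bar>jet_form h (X n) [v, v]\<bar> \<le> \<bar>jet_form h (X n) [u, u]\<bar>"
    using diagonalizing_frame[OF X_in subspace_V] dim_V assms by simp
  from choice[OF this] obtain u where "\<forall>n. \<exists>v. u n \<in> V n \<and> v \<in> V n \<and> norm (u n) = 1 \<and> norm v = 1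
    \<and> u n \<bullet> v = 0 \<and> jet_form h (X n) [u n, v] = 0
    \<and> \<bar>jet_form h (X n) [v, v]\<bar> \<le> \<bar>jet_form h (X n) [u n, u n]\<bar>" by blast
  from choice[OF this] obtain v where uv: "\<And>n. u n \<in> V n \<and> v n \<in> V n \<and> norm (u n) = 1 \<and> norm (v n) = 1
    \<and> u n \<bullet> v n = 0 \<and> jet_form h (X n) [u n, v n] = 0
    \<and> \<bar>jet_form h (X n) [v n, v n]\<bar> \<le> \<bar>jet_form h (X n) [u n, u n]\<bar>" by blast
  obtain u' where u': "(u \<longlongrightarrow> u') F" using unit_tendsto[of u] uv by blast
  obtain v' where v': "(v \<longlongrightarrow> v') F" using unit_tendsto[of v] uv by blast
  have "flat_plane_sequence A h m x X V \<xi> \<epsilon> Q F u v u' v'"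
    by unfold_locales (use assms uv u' v' in blast)+
  then show ?thesis by blast
qed

context flat_plane_sequence
begin

lemma limit_frame:
  "norm u' = 1" "norm v' = 1" "u' \<bullet> v' = 0" "jet_form h x [u'] = 0" "jet_form h x [v'] = 0"
  "jet_form h x [u', v'] = 0"
proof -
  show "norm u' = 1" using tendsto_norm[OF u_lim] norm_u by (simp add: tendsto_const_iff F_nontrivial)
  show "norm v' = 1" using tendsto_norm[OF v_lim] norm_v by (simp add: tendsto_const_iff F_nontrivial)
  show "u' \<bullet> v' = 0" using tendsto_inner[OF u_lim v_lim] orth by (simp add: tendsto_const_iff F_nontrivial)
  show "jet_form h x [u'] = 0" "jet_form h x [v'] = 0"
    using limit_orth[OF u_in u_lim] limit_orth[OF v_in v_lim] by (simp_all add: jet_form_1)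
  show "jet_form h x [u', v'] = 0"
    using jets_tendsto[of "[u, v]" "[u', v']"] u_lim v_lim diag by (simp add: tendsto_const_iff F_nontrivial)
qed

lemma diag': "jet_form h (X n) [v n, u n] = 0"
  using diag jet_form_2_commute[OF X_in] by metis

abbreviation "a n \<equiv> jet_form h (X n) [u n, u n]"
abbreviation "d n \<equiv> jet_form h (X n) [v n, v n]"

lemma a_lim: "(a \<longlongrightarrow> jet_form h x [u', u']) F"
  using jets_tendsto[of "[u, u]" "[u', u']"] u_lim by simp

lemma d_lim: "(d \<longlongrightarrow> jet_form h x [v', v']) F"
  using jets_tendsto[of "[v, v]" "[v', v']"] v_lim by simp

lemma Q_expansion:
  assumes "0 \<le> r" "r \<le> 1"
  shows "Q n r = (Q n r \<bullet> v n) *\<^sub>R v n + (Q n r \<bullet> u n) *\<^sub>R u n"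
  using m by (intro orthonormal_2_expansion[of "V n"] dim_V[THEN trans] u_in v_in norm_u norm_v orth Q_in assms)

lemma Q_limit:
  assumes r: "0 \<le> r" "r \<le> 1"
  obtains s y where "((\<lambda>n. Q n r) \<longlongrightarrow> s *\<^sub>R v' + y *\<^sub>R u') F" "((\<lambda>n. Q n r \<bullet> v n) \<longlongrightarrow> s) F"
    "((\<lambda>n. Q n r \<bullet> u n) \<longlongrightarrow> y) F" "s\<^sup>2 + y\<^sup>2 = r\<^sup>2"
proof -
  obtain q where q: "((\<lambda>n. Q n r) \<longlongrightarrow> q) F" "norm q = r" using Q_tendsto[OF r] by blast
  have s: "((\<lambda>n. Q n r \<bullet> v n) \<longlongrightarrow> q \<bullet> v') F" and y: "((\<lambda>n. Q n r \<bullet> u n) \<longlongrightarrow> q \<bullet> u') F"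
    by (intro tendsto_inner q u_lim v_lim)+
  have "((\<lambda>n. (Q n r \<bullet> v n) *\<^sub>R v n + (Q n r \<bullet> u n) *\<^sub>R u n) \<longlongrightarrow> (q \<bullet> v') *\<^sub>R v' + (q \<bullet> u') *\<^sub>R u') F"
    by (intro tendsto_intros s y u_lim v_lim)
  then have q': "((\<lambda>n. Q n r) \<longlongrightarrow> (q \<bullet> v') *\<^sub>R v' + (q \<bullet> u') *\<^sub>R u') F"
    using Q_expansion[OF r] by simp
  then have eq: "q = (q \<bullet> v') *\<^sub>R v' + (q \<bullet> u') *\<^sub>R u'" using q(1) by (rule tendsto_unique[OF F_nontrivial, rotated])
  have "r\<^sup>2 = q \<bullet> q" using q(2) by (simp add: dot_square_norm)
  also have "\<dots> = (q \<bullet> v') * (q \<bullet> v') + (q \<bullet> u') * (q \<bullet> u')"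
    by (subst (2) eq) (simp add: inner_add_right)
  finally show ?thesis using that[OF q' s y] by (simp add: power2_eq_square)
qed

text \<open>The quantity that tends to 0 by \<open>Taylor_small\<close>, with test vector
  \<open>W\<close>.\<close>

definition err :: "real \<Rightarrow> (nat \<Rightarrow> real^'n) \<Rightarrow> nat \<Rightarrow> real" where
  "err r W n = (jet_form h (X n) [Q n r, W n] + \<xi> n / 2 * jet_form h (X n) [Q n r, Q n r, W n]
      + \<xi> n ^ 2 / 6 * jet_form h (X n) [Q n r, Q n r, Q n r, W n]
      + \<xi> n ^ 3 / 24 * jet_form h (X n) [Q n r, Q n r, Q n r, Q n r, W n]) / \<xi> n ^ 3"

lemma err_lim:
  assumes r: "0 \<le> r" "r \<le> 1"
  shows "(err r u \<longlongrightarrow> 0) F" "(err r v \<longlongrightarrow> 0) F"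
proof -
  obtain q where q: "((\<lambda>n. Q n r) \<longlongrightarrow> q) F" using Q_tendsto[OF r] by blast
  show "(err r u \<longlongrightarrow> 0) F" "(err r v \<longlongrightarrow> 0) F"
    unfolding err_def[abs_def]
    using Taylor_small[OF r q u_in u_lim] Taylor_small[OF r q v_in v_lim] by blast+
qed

text \<open>In a diagonalising frame the Hessian term splits into the two coordinates. With this
  scaling it appears as \<open>a n / \<xi> n\<close> or \<open>d n / \<xi> n\<close> next to the
  cubic term, and the size of \<open>a n / \<xi> n\<close> separates the two cases below.\<close>

lemma err_eq:
  assumes r: "0 \<le> r" "r \<le> 1"
  shows "\<xi> n ^ 2 * err r u n = (Q n r \<bullet> u n) * a n / \<xi> n + jet_form h (X n) [Q n r, Q n r, u n] / 2
      + \<xi> n / 6 * jet_form h (X n) [Q n r, Q n r, Q n r, u n]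
      + \<xi> n ^ 2 / 24 * jet_form h (X n) [Q n r, Q n r, Q n r, Q n r, u n]"
    and "\<xi> n ^ 2 * err r v n = (Q n r \<bullet> v n) * d n / \<xi> n + jet_form h (X n) [Q n r, Q n r, v n] / 2
      + \<xi> n / 6 * jet_form h (X n) [Q n r, Q n r, Q n r, v n]
      + \<xi> n ^ 2 / 24 * jet_form h (X n) [Q n r, Q n r, Q n r, Q n r, v n]"
proof -
  have "jet_form h (X n) [Q n r, u n] = (Q n r \<bullet> u n) * a n"
    by (subst Q_expansion[OF r]) (simp add: jet_form_2_linear diag')
  then show "\<xi> n ^ 2 * err r u n = (Q n r \<bullet> u n) * a n / \<xi> n + jet_form h (X n) [Q n r, Q n r, u n] / 2
      + \<xi> n / 6 * jet_form h (X n) [Q n r, Q n r, Q n r, u n]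
      + \<xi> n ^ 2 / 24 * jet_form h (X n) [Q n r, Q n r, Q n r, Q n r, u n]"
    unfolding err_def using \<xi>_pos[of n] by (simp add: field_simps eval_nat_numeral)
  have "jet_form h (X n) [Q n r, v n] = (Q n r \<bullet> v n) * d n"
    by (subst Q_expansion[OF r]) (simp add: jet_form_2_linear diag)
  then show "\<xi> n ^ 2 * err r v n = (Q n r \<bullet> v n) * d n / \<xi> n + jet_form h (X n) [Q n r, Q n r, v n] / 2
      + \<xi> n / 6 * jet_form h (X n) [Q n r, Q n r, Q n r, v n]
      + \<xi> n ^ 2 / 24 * jet_form h (X n) [Q n r, Q n r, Q n r, Q n r, v n]"
    unfolding err_def using \<xi>_pos[of n] by (simp add: field_simps eval_nat_numeral)
qed

text \<open>\<alpha> and \<delta> are the limits of \<open>a n / \<xi> n\<close> and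
  \<open>d n / \<xi> n\<close>. The limit equations say that half of the quadratic form with
  diagonal entries \<delta> and \<alpha>, plus one sixth of the cubic form, has a critical point on
  every circle of radius at most 1.\<close>

lemma bounded_case:
  assumes "eventually (\<lambda>n. \<bar>a n\<bar> \<le> M * \<xi> n) F"
  shows "jet_form h x [u', u'] = 0" "jet_form h x [v', v'] = 0"
    and "\<exists>\<alpha> \<delta>. \<forall>r\<in>{0..1}. \<exists>s y. s\<^sup>2 + y\<^sup>2 = r\<^sup>2 \<and> (let q = s *\<^sub>R v' + y *\<^sub>R u' in
      \<delta> * s + jet_form h x [q, q, v'] / 2 = 0 \<and> \<alpha> * y + jet_form h x [q, q, u'] / 2 = 0)"
proof -
  have quot: "dist 0 (z / \<xi> n) \<le> M" if "\<bar>z\<bar> \<le> M * \<xi> n" for z n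
    using that \<xi>_pos[of n] by (simp add: abs_divide divide_le_eq)
  have "eventually (\<lambda>n. dist 0 (a n / \<xi> n) \<le> M) F"
    using assms by eventually_elim (rule quot)
  from ultrafilter_tendsto_bounded[OF F this]
  obtain \<alpha> where \<alpha>: "((\<lambda>n. a n / \<xi> n) \<longlongrightarrow> \<alpha>) F" ..
  have "eventually (\<lambda>n. dist 0 (d n / \<xi> n) \<le> M) F"
    using assms by eventually_elim (rule quot, rule order_trans[OF le])
  from ultrafilter_tendsto_bounded[OF F this]
  obtain \<delta> where \<delta>: "((\<lambda>n. d n / \<xi> n) \<longlongrightarrow> \<delta>) F" ..
  have "((\<lambda>n. a n / \<xi> n * \<xi> n) \<longlongrightarrow> \<alpha> * 0) F" "((\<lambda>n. d n / \<xi> n * \<xi> n) \<longlongrightarrow> \<delta> * 0) F"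
    by (intro tendsto_mult \<alpha> \<delta> \<xi>)+
  moreover have "a n / \<xi> n * \<xi> n = a n" "d n / \<xi> n * \<xi> n = d n" for n
    using \<xi>_pos[of n] by simp_all
  ultimately have "(a \<longlongrightarrow> 0) F" "(d \<longlongrightarrow> 0) F" by simp_all
  then show "jet_form h x [u', u'] = 0" "jet_form h x [v', v'] = 0"
    using tendsto_unique[OF F_nontrivial a_lim] tendsto_unique[OF F_nontrivial d_lim] by blast+
  show "\<exists>\<alpha> \<delta>. \<forall>r\<in>{0..1}. \<exists>s y. s\<^sup>2 + y\<^sup>2 = r\<^sup>2 \<and> (let q = s *\<^sub>R v' + y *\<^sub>R u' in
      \<delta> * s + jet_form h x [q, q, v'] / 2 = 0 \<and> \<alpha> * y + jet_form h x [q, q, u'] / 2 = 0)"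
  proof (rule exI[of _ \<alpha>], rule exI[of _ \<delta>], rule ballI)
    fix r :: real assume "r \<in> {0..1}"
    then have r: "0 \<le> r" "r \<le> 1" by auto
    obtain s y where q: "((\<lambda>n. Q n r) \<longlongrightarrow> s *\<^sub>R v' + y *\<^sub>R u') F" and s: "((\<lambda>n. Q n r \<bullet> v n) \<longlongrightarrow> s) F"
      and y: "((\<lambda>n. Q n r \<bullet> u n) \<longlongrightarrow> y) F" and sy: "s\<^sup>2 + y\<^sup>2 = r\<^sup>2"
      by (rule Q_limit[OF r])
    let ?q = "s *\<^sub>R v' + y *\<^sub>R u'" and ?Q = "\<lambda>n. Q n r"
    have J: "((\<lambda>n. jet_form h (X n) [?Q n, ?Q n, W n]) \<longlongrightarrow> jet_form h x [?q, ?q, w]) F"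
      "((\<lambda>n. jet_form h (X n) [?Q n, ?Q n, ?Q n, W n]) \<longlongrightarrow> jet_form h x [?q, ?q, ?q, w]) F"
      "((\<lambda>n. jet_form h (X n) [?Q n, ?Q n, ?Q n, ?Q n, W n]) \<longlongrightarrow> jet_form h x [?q, ?q, ?q, ?q, w]) F"
      if "(W \<longlongrightarrow> w) F" for W w
      using jets_tendsto[of "[?Q, ?Q, W]" "[?q, ?q, w]"] jets_tendsto[of "[?Q, ?Q, ?Q, W]" "[?q, ?q, ?q, w]"]
        jets_tendsto[of "[?Q, ?Q, ?Q, ?Q, W]" "[?q, ?q, ?q, ?q, w]"] q that by simp_all
    have "((\<lambda>n. \<xi> n ^ 2 * err r u n) \<longlongrightarrow> y * \<alpha> + jet_form h x [?q, ?q, u'] / 2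
      + 0 / 6 * jet_form h x [?q, ?q, ?q, u'] + 0 ^ 2 / 24 * jet_form h x [?q, ?q, ?q, ?q, u']) F"
      unfolding err_eq[OF r] times_divide_eq_right[symmetric, of _ "a _"]
      by (intro tendsto_intros y \<alpha> J[OF u_lim] \<xi>; simp)
    moreover have "((\<lambda>n. \<xi> n ^ 2 * err r u n) \<longlongrightarrow> 0 ^ 2 * 0) F"
      by (intro tendsto_mult tendsto_power \<xi> err_lim r)
    ultimately have "y * \<alpha> + jet_form h x [?q, ?q, u'] / 2
      + 0 / 6 * jet_form h x [?q, ?q, ?q, u'] + 0 ^ 2 / 24 * jet_form h x [?q, ?q, ?q, ?q, u'] = 0 ^ 2 * 0"
      by (rule tendsto_unique[OF F_nontrivial])
    then have 1: "\<alpha> * y + jet_form h x [?q, ?q, u'] / 2 = 0" by (simp add: mult.commute)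
    have "((\<lambda>n. \<xi> n ^ 2 * err r v n) \<longlongrightarrow> s * \<delta> + jet_form h x [?q, ?q, v'] / 2
      + 0 / 6 * jet_form h x [?q, ?q, ?q, v'] + 0 ^ 2 / 24 * jet_form h x [?q, ?q, ?q, ?q, v']) F"
      unfolding err_eq[OF r] times_divide_eq_right[symmetric, of _ "d _"]
      by (intro tendsto_intros s \<delta> J[OF v_lim] \<xi>; simp)
    moreover have "((\<lambda>n. \<xi> n ^ 2 * err r v n) \<longlongrightarrow> 0 ^ 2 * 0) F"
      by (intro tendsto_mult tendsto_power \<xi> err_lim r)
    ultimately have "s * \<delta> + jet_form h x [?q, ?q, v'] / 2
      + 0 / 6 * jet_form h x [?q, ?q, ?q, v'] + 0 ^ 2 / 24 * jet_form h x [?q, ?q, ?q, ?q, v'] = 0 ^ 2 * 0"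
      by (rule tendsto_unique[OF F_nontrivial])
    then have 2: "\<delta> * s + jet_form h x [?q, ?q, v'] / 2 = 0" by (simp add: mult.commute)
    show "\<exists>s y. s\<^sup>2 + y\<^sup>2 = r\<^sup>2 \<and> (let q = s *\<^sub>R v' + y *\<^sub>R u' in
      \<delta> * s + jet_form h x [q, q, v'] / 2 = 0 \<and> \<alpha> * y + jet_form h x [q, q, u'] / 2 = 0)"
      unfolding Let_def using sy 1 2 by blast
  qed
qed

end

section \<open>Expansion in the frame and the unbounded case\<close>

context smooth_on_open
begin

lemma jet_form_4_linear:
  "jet_form h x [p + p', q, w, z] = jet_form h x [p, q, w, z] + jet_form h x [p', q, w, z]"
  "jet_form h x [p, q + q', w, z] = jet_form h x [p, q, w, z] + jet_form h x [p, q', w, z]"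
  "jet_form h x [p, q, w + w', z] = jet_form h x [p, q, w, z] + jet_form h x [p, q, w', z]"
  "jet_form h x [a *\<^sub>R p, q, w, z] = a * jet_form h x [p, q, w, z]"
  "jet_form h x [p, a *\<^sub>R q, w, z] = a * jet_form h x [p, q, w, z]"
  "jet_form h x [p, q, a *\<^sub>R w, z] = a * jet_form h x [p, q, w, z]"
  using jet_form_add[of x "[]" p p' "[q, w, z]"] jet_form_add[of x "[p]" q q' "[w, z]"]
    jet_form_add[of x "[p, q]" w w' "[z]"]
    jet_form_scaleR[of x "[]" a p "[q, w, z]"] jet_form_scaleR[of x "[p]" a q "[w, z]"]
    jet_form_scaleR[of x "[p, q]" a w "[z]"]
  by simp_all

lemma jet_form_3_expansion:
  fixes s y :: real and u v :: "real^'n"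
  defines "q \<equiv> s *\<^sub>R v + y *\<^sub>R u"
  assumes x: "x \<in> A"
  shows "jet_form h x [q, q, v]
      = s\<^sup>2 * jet_form h x [v, v, v] + 2 * s * y * jet_form h x [v, v, u] + y\<^sup>2 * jet_form h x [u, u, v]"
    and "jet_form h x [q, q, u]
      = s\<^sup>2 * jet_form h x [v, v, u] + 2 * s * y * jet_form h x [u, u, v] + y\<^sup>2 * jet_form h x [u, u, u]"
proof -
  have sym: "jet_form h x [u, v, v] = jet_form h x [v, v, u]" "jet_form h x [v, u, v] = jet_form h x [v, v, u]"
    "jet_form h x [v, u, u] = jet_form h x [u, u, v]" "jet_form h x [u, v, u] = jet_form h x [u, u, v]"
    by (rule jet_form_mset[OF x]; simp)+
  show "jet_form h x [q, q, v]
      = s\<^sup>2 * jet_form h x [v, v, v] + 2 * s * y * jet_form h x [v, v, u] + y\<^sup>2 * jet_form h x [u, u, v]"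
    unfolding q_def jet_form_3_linear sym by (simp add: power2_eq_square algebra_simps)
  show "jet_form h x [q, q, u]
      = s\<^sup>2 * jet_form h x [v, v, u] + 2 * s * y * jet_form h x [u, u, v] + y\<^sup>2 * jet_form h x [u, u, u]"
    unfolding q_def jet_form_3_linear sym by (simp add: power2_eq_square algebra_simps)
qed

text \<open>The terms divisible by the square of \<open>y\<close> are kept together because they
  become negligible when \<open>y\<close> is of order \<sigma>.\<close>

lemma jet_form_4_expansion:
  fixes s y :: real and u v :: "real^'n"
  defines "q \<equiv> s *\<^sub>R v + y *\<^sub>R u"
  assumes x: "x \<in> A"
  shows "jet_form h x [q, q, q, v] = s ^ 3 * jet_form h x [v, v, v, v] + 3 * s\<^sup>2 * y * jet_form h x [v, v, v, u]
      + y\<^sup>2 * (3 * s * jet_form h x [v, v, u, u] + y * jet_form h x [v, u, u, u])"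
proof -
  have sym: "jet_form h x [u, v, v, v] = jet_form h x [v, v, v, u]" "jet_form h x [v, u, v, v] = jet_form h x [v, v, v, u]"
    "jet_form h x [v, v, u, v] = jet_form h x [v, v, v, u]"
    "jet_form h x [v, u, u, v] = jet_form h x [v, v, u, u]" "jet_form h x [u, v, u, v] = jet_form h x [v, v, u, u]"
    "jet_form h x [u, u, v, v] = jet_form h x [v, v, u, u]" "jet_form h x [u, u, u, v] = jet_form h x [v, u, u, u]"
    by (rule jet_form_mset[OF x]; simp)+
  show ?thesis
    unfolding q_def jet_form_4_linear sym
    by (simp add: power2_eq_square power3_eq_cube algebra_simps)
qed

end

context flat_plane_sequence
begin

text \<open>With \<open>\<sigma> = \<xi> / a \<rightarrow> 0\<close>, a point \<open>\<xi> (s v + y u)\<close> of small gradient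
  has \<open>y = \<sigma> \<rho>\<close> and \<open>\<rho> = - b s\<^sup>2 / 2 + \<sigma> \<omega>\<close> with \<open>\<omega>\<close> bounded.  Substituted into the derivative along
  \<open>v\<close> this leaves a quartic polynomial in \<open>s\<close> alone, small at points of every modulus.\<close>

lemma degenerate_case:
  assumes unbdd: "\<And>M. eventually (\<lambda>n. M * \<xi> n < \<bar>a n\<bar>) F"
  defines "al \<equiv> jet_form h x [u', u']" and "b \<equiv> jet_form h x [v', v', u']" and "c \<equiv> jet_form h x [u', u', v']"
    and "g \<equiv> jet_form h x [v', v', v', v', v']" and "e \<equiv> jet_form h x [v', v', v', u']"
  shows "jet_form h x [v', v'] = 0" "jet_form h x [v', v', v'] = 0"
    "al * jet_form h x [v', v', v', v'] = 3 * b\<^sup>2" "15 * b\<^sup>2 * c + g * al\<^sup>2 = 10 * e * b * al"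
proof -
  define \<sigma> where "\<sigma> n = \<xi> n / a n" for n
  have a_nz: "eventually (\<lambda>n. a n \<noteq> 0) F" using unbdd[of 0] by eventually_elim auto
  have \<sigma>0: "(\<sigma> \<longlongrightarrow> 0) F"
    unfolding tendsto_iff
  proof (intro allI impI)
    fix \<eta> :: real assume "0 < \<eta>"
    show "eventually (\<lambda>n. dist (\<sigma> n) 0 < \<eta>) F"
      using unbdd[of "1 / \<eta>"] a_nz
    proof eventually_elim
      case (elim n)
      then have "\<xi> n < \<eta> * \<bar>a n\<bar>" using \<open>0 < \<eta>\<close> by (simp add: divide_less_eq mult.commute)
      then show ?case using elim \<xi>_pos[of n] by (simp add: \<sigma>_def divide_less_eq abs_divide)
    qed
  qed
  have ev: "eventually (\<lambda>n. \<sigma> n \<noteq> 0 \<and> \<xi> n = \<sigma> n * a n) F"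
    using a_nz by eventually_elim (use \<xi>_pos in \<open>simp add: \<sigma>_def less_imp_neq[symmetric]\<close>)
  let ?J = "\<lambda>n. jet_form h (X n)"
  define \<Gamma> where "\<Gamma> = 15 * b\<^sup>2 * c - 10 * al * e * b + g * al\<^sup>2"
  \<comment> \<open>Coefficients of the quartic in \<open>s\<close>, with 0 as the constant one.
    Entries 1 to 3 have denominators tending to 0, so smallness of these entries forces the
    numerators to vanish in the limit; entry 4 is already the limit value.\<close>
  define C where "C = (\<lambda>j n. [0, d n / (\<xi> n * \<sigma> n ^ 2), ?J n [v n, v n, v n] / (2 * \<sigma> n ^ 2),
    (a n * ?J n [v n, v n, v n, v n] - 3 * (?J n [v n, v n, u n])\<^sup>2) / (6 * \<sigma> n), \<Gamma> / 24] ! j)"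
  have J_lim: "((\<lambda>n. ?J n [v n, v n, v n]) \<longlongrightarrow> jet_form h x [v', v', v']) F"
    "((\<lambda>n. ?J n [v n, v n, u n]) \<longlongrightarrow> b) F" "((\<lambda>n. ?J n [u n, u n, v n]) \<longlongrightarrow> c) F"
    "((\<lambda>n. ?J n [u n, u n, u n]) \<longlongrightarrow> jet_form h x [u', u', u']) F"
    "((\<lambda>n. ?J n [v n, v n, v n, v n]) \<longlongrightarrow> jet_form h x [v', v', v', v']) F"
    "((\<lambda>n. ?J n [v n, v n, v n, u n]) \<longlongrightarrow> e) F"
    "((\<lambda>n. ?J n [v n, v n, u n, u n]) \<longlongrightarrow> jet_form h x [v', v', u', u']) F"
    "((\<lambda>n. ?J n [v n, u n, u n, u n]) \<longlongrightarrow> jet_form h x [v', u', u', u']) F"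
    using jets_tendsto[of "[v, v, v]" "[v', v', v']"] jets_tendsto[of "[v, v, u]" "[v', v', u']"]
      jets_tendsto[of "[u, u, v]" "[u', u', v']"] jets_tendsto[of "[u, u, u]" "[u', u', u']"]
      jets_tendsto[of "[v, v, v, v]" "[v', v', v', v']"] jets_tendsto[of "[v, v, v, u]" "[v', v', v', u']"]
      jets_tendsto[of "[v, v, u, u]" "[v', v', u', u']"] jets_tendsto[of "[v, u, u, u]" "[v', u', u', u']"]
      u_lim v_lim by (simp_all add: b_def c_def e_def)
  have al: "(a \<longlongrightarrow> al) F" unfolding al_def by (rule a_lim)
  have C0: "(C i \<longlongrightarrow> 0) F" if "i \<le> 4" for i
  proof (rule poly_coeffs_tendsto_0[OF F _ that])
    fix r :: real assume r: "0 \<le> r" "r \<le> 1"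
    define s where "s n = Q n r \<bullet> v n" for n
    define y where "y n = Q n r \<bullet> u n" for n
    define \<rho> where "\<rho> n = y n * a n / \<xi> n" for n
    define \<omega> where "\<omega> n = (\<rho> n + s n ^ 2 * ?J n [v n, v n, u n] / 2) / \<sigma> n" for n
    let ?Q = "\<lambda>n. Q n r"
    obtain l y' where q: "((\<lambda>n. Q n r) \<longlongrightarrow> l *\<^sub>R v' + y' *\<^sub>R u') F" and s: "(s \<longlongrightarrow> l) F"
      and y: "(y \<longlongrightarrow> y') F" and ly: "l\<^sup>2 + y'\<^sup>2 = r\<^sup>2"
      unfolding s_def y_def by (rule Q_limit[OF r])
    let ?q = "l *\<^sub>R v' + y' *\<^sub>R u'"
    have Q_eq: "?Q n = s n *\<^sub>R v n + y n *\<^sub>R u n" for n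
      unfolding s_def y_def by (rule Q_expansion[OF r])
    have JQ: "((\<lambda>n. ?J n [?Q n, ?Q n, W n]) \<longlongrightarrow> jet_form h x [?q, ?q, w]) F"
      "((\<lambda>n. ?J n [?Q n, ?Q n, ?Q n, W n]) \<longlongrightarrow> jet_form h x [?q, ?q, ?q, w]) F"
      "((\<lambda>n. ?J n [?Q n, ?Q n, ?Q n, ?Q n, W n]) \<longlongrightarrow> jet_form h x [?q, ?q, ?q, ?q, w]) F"
      if "(W \<longlongrightarrow> w) F" for W w
      using jets_tendsto[of "[?Q, ?Q, W]" "[?q, ?q, w]"] jets_tendsto[of "[?Q, ?Q, ?Q, W]" "[?q, ?q, ?q, w]"]
        jets_tendsto[of "[?Q, ?Q, ?Q, ?Q, W]" "[?q, ?q, ?q, ?q, w]"] q that by simp_all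
    note Ju = JQ[OF u_lim] and Jv = JQ[OF v_lim]
    have \<rho>_eq: "\<rho> n = \<xi> n ^ 2 * err r u n - ?J n [?Q n, ?Q n, u n] / 2 - \<xi> n / 6 * ?J n [?Q n, ?Q n, ?Q n, u n]
        - \<xi> n ^ 2 / 24 * ?J n [?Q n, ?Q n, ?Q n, ?Q n, u n]" for n
      unfolding err_eq(1)[OF r] \<rho>_def y_def by simp
    have \<rho>: "(\<rho> \<longlongrightarrow> 0 ^ 2 * 0 - jet_form h x [?q, ?q, u'] / 2 - 0 / 6 * jet_form h x [?q, ?q, ?q, u']
        - 0 ^ 2 / 24 * jet_form h x [?q, ?q, ?q, ?q, u']) F"
      unfolding \<rho>_eq[abs_def] by (intro tendsto_intros Ju \<xi> err_lim r; simp)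
    have y_eq: "eventually (\<lambda>n. y n = \<sigma> n * \<rho> n) F"
      using a_nz by eventually_elim (use \<xi>_pos in \<open>simp add: \<sigma>_def \<rho>_def less_imp_neq[symmetric]\<close>)
    \<comment> \<open>Since \<rho> converges and \<sigma> tends to 0, the limit point lies on the
      axis of \<open>v'\<close>. Its coordinate \<open>l\<close> therefore has modulus
      \<open>r\<close>.\<close>
    have "y' = 0"
    proof -
      have "((\<lambda>n. \<sigma> n * \<rho> n) \<longlongrightarrow> 0) F" using tendsto_mult[OF \<sigma>0 \<rho>] by simp
      then have "(y \<longlongrightarrow> 0) F" using y_eq by (simp add: tendsto_cong)
      then show ?thesis by (rule tendsto_unique[OF F_nontrivial y])
    qed
    then have q_eq: "?q = l *\<^sub>R v'" by simp
    have "\<bar>l\<bar> = r" using ly \<open>y' = 0\<close> r by (simp add: power2_eq_iff) linarith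
    have \<rho>_lim: "(\<rho> \<longlongrightarrow> - (l\<^sup>2 * b / 2)) F"
      using \<rho> unfolding q_eq jet_form_scaleR_front by (simp add: b_def)
    \<comment> \<open>In the equation along \<open>u\<close>, every term of \<rho> other than the
      one with the square of \<open>s\<close> contains a factor \<sigma>, because
      \<open>\<xi> n = \<sigma> n * a n\<close> and \<open>y n = \<sigma> n * \<rho> n\<close>.
      Cancelling it writes \<omega> without a small denominator, so \<omega> converges.\<close>
    have \<omega>_eq: "eventually (\<lambda>n. a n * \<xi> n * err r u n - s n * \<rho> n * ?J n [u n, u n, v n]
        - \<rho> n * y n * ?J n [u n, u n, u n] / 2 - a n / 6 * ?J n [?Q n, ?Q n, ?Q n, u n]
        - a n * \<xi> n / 24 * ?J n [?Q n, ?Q n, ?Q n, ?Q n, u n] = \<omega> n) F"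
      using ev y_eq
    proof eventually_elim
      case (elim n)
      have "\<rho> n + s n ^ 2 * ?J n [v n, v n, u n] / 2 = \<sigma> n * (a n * \<xi> n * err r u n - s n * \<rho> n * ?J n [u n, u n, v n]
        - \<rho> n * y n * ?J n [u n, u n, u n] / 2 - a n / 6 * ?J n [?Q n, ?Q n, ?Q n, u n]
        - a n * \<xi> n / 24 * ?J n [?Q n, ?Q n, ?Q n, ?Q n, u n])"
      proof -
        have J3: "?J n [?Q n, ?Q n, u n] = s n ^ 2 * ?J n [v n, v n, u n] + 2 * s n * (\<sigma> n * \<rho> n) * ?J n [u n, u n, v n]
            + (\<sigma> n * \<rho> n) * y n * ?J n [u n, u n, u n]"
          using jet_form_3_expansion(2)[OF X_in[of n], of "s n" "v n" "y n" "u n"] elim(2)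
          by (simp add: Q_eq power2_eq_square)
        have "R + t\<^sup>2 * B / 2 - S * (k * (S * k) * E - t * R * D - R * Y * K / 2 - k / 6 * G - k * (S * k) / 24 * H)
          = R - ((S * k)\<^sup>2 * E - (t\<^sup>2 * B + 2 * t * (S * R) * D + S * R * Y * K) / 2 - S * k / 6 * G - (S * k)\<^sup>2 / 24 * H)"
          for R t B S k E D Y K G H :: real
          by (simp add: power2_eq_square field_simps)
        note identity = this[of "\<rho> n" "s n" "?J n [v n, v n, u n]" "\<sigma> n" "a n" "err r u n" "?J n [u n, u n, v n]"
            "y n" "?J n [u n, u n, u n]" "?J n [?Q n, ?Q n, ?Q n, u n]" "?J n [?Q n, ?Q n, ?Q n, ?Q n, u n]"]
        have xi: "\<sigma> n * a n = \<xi> n" using elim(1) by simp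
        show ?thesis
          by (rule iffD1[OF right_minus_eq], rule trans[OF identity[unfolded xi]], rule iffD2[OF right_minus_eq],
              rule \<rho>_eq[of n, unfolded J3])
      qed
      then show ?case using elim by (simp add: \<omega>_def)
    qed
    define \<omega>l where "\<omega>l = l ^ 3 * b * c / 2 - al * l ^ 3 * e / 6"
    have \<omega>_lim: "(\<omega> \<longlongrightarrow> \<omega>l) F"
    proof -
      have "((\<lambda>n. a n * \<xi> n * err r u n - s n * \<rho> n * ?J n [u n, u n, v n]
        - \<rho> n * y n * ?J n [u n, u n, u n] / 2 - a n / 6 * ?J n [?Q n, ?Q n, ?Q n, u n]
        - a n * \<xi> n / 24 * ?J n [?Q n, ?Q n, ?Q n, ?Q n, u n]) \<longlongrightarrow>
        al * 0 * 0 - l * (- (l\<^sup>2 * b / 2)) * c - - (l\<^sup>2 * b / 2) * y' * jet_form h x [u', u', u'] / 2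
        - al / 6 * jet_form h x [?q, ?q, ?q, u'] - al * 0 / 24 * jet_form h x [?q, ?q, ?q, ?q, u']) F"
        by (intro tendsto_intros al \<xi> err_lim r s y \<rho>_lim J_lim Ju; simp)
      moreover have "al * 0 * 0 - l * (- (l\<^sup>2 * b / 2)) * c - - (l\<^sup>2 * b / 2) * y' * jet_form h x [u', u', u'] / 2
        - al / 6 * jet_form h x [?q, ?q, ?q, u'] - al * 0 / 24 * jet_form h x [?q, ?q, ?q, ?q, u'] = \<omega>l"
        unfolding q_eq jet_form_scaleR_front
        by (simp add: \<open>y' = 0\<close> \<omega>l_def e_def power2_eq_square power3_eq_cube)
      ultimately show ?thesis using \<omega>_eq by (simp add: tendsto_cong)
    qed
    \<comment> \<open>The part of the equation along \<open>v\<close> that stays bounded after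
      division by the square of \<sigma>. Its limit is \<Gamma>/24 times the fourth power of
      \<open>l\<close>, so it may be exchanged for the quartic term with constant
      coefficient.\<close>
    let ?T = "\<lambda>n. s n * ?J n [v n, v n, u n] * \<omega> n + \<rho> n ^ 2 * ?J n [u n, u n, v n] / 2
      + a n * s n ^ 2 * \<rho> n * ?J n [v n, v n, v n, u n] / 2
      + \<xi> n / 6 * \<rho> n ^ 2 * (3 * s n * ?J n [v n, v n, u n, u n] + y n * ?J n [v n, u n, u n, u n])
      + a n ^ 2 / 24 * ?J n [?Q n, ?Q n, ?Q n, ?Q n, v n]"
    have sum_eq: "eventually (\<lambda>n. a n ^ 2 * err r v n - ?T n + \<Gamma> / 24 * s n ^ 4 = (\<Sum>j\<le>4. C j n * s n ^ j)) F"
      using ev y_eq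
    proof eventually_elim
      case (elim n)
      define S where "S = \<sigma> n"
      have S: "S \<noteq> 0" "\<xi> n = S * a n" "y n = S * \<rho> n" "a n \<noteq> 0" "\<xi> n \<noteq> 0"
        using elim \<xi>_pos[of n] by (auto simp: S_def)
      have \<rho>\<omega>: "\<rho> n = S * \<omega> n - s n ^ 2 * ?J n [v n, v n, u n] / 2"
        using S(1) by (simp add: \<omega>_def S_def)
      have J3: "?J n [?Q n, ?Q n, v n] = s n ^ 2 * ?J n [v n, v n, v n]
          + 2 * s n * y n * ?J n [v n, v n, u n] + y n ^ 2 * ?J n [u n, u n, v n]"
        using jet_form_3_expansion(1)[OF X_in[of n], of "s n" "v n" "y n" "u n"] by (simp add: Q_eq)
      have J4: "?J n [?Q n, ?Q n, ?Q n, v n] = s n ^ 3 * ?J n [v n, v n, v n, v n] + 3 * s n ^ 2 * y n * ?J n [v n, v n, v n, u n]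
          + y n ^ 2 * (3 * s n * ?J n [v n, v n, u n, u n] + y n * ?J n [v n, u n, u n, u n])"
        using jet_form_4_expansion[OF X_in[of n], of "s n" "v n" "y n" "u n"] by (simp add: Q_eq)
      \<comment> \<open>Division by the square of \<sigma> turns the square of \<xi> into that of
        \<open>a n\<close>, which converges; the left side therefore still tends to 0.\<close>
      have "a n ^ 2 * err r v n = (\<xi> n ^ 2 * err r v n) / S\<^sup>2"
        using S by (simp add: power_mult_distrib)
      also have "\<dots> = (s n * d n / \<xi> n + ?J n [?Q n, ?Q n, v n] / 2 + \<xi> n / 6 * ?J n [?Q n, ?Q n, ?Q n, v n]
          + \<xi> n ^ 2 / 24 * ?J n [?Q n, ?Q n, ?Q n, ?Q n, v n]) / S\<^sup>2"
        unfolding err_eq(2)[OF r] s_def ..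
      also have "\<dots> = s n * d n / (\<xi> n * S\<^sup>2) + s n ^ 2 * ?J n [v n, v n, v n] / (2 * S\<^sup>2)
          + s n * \<rho> n * ?J n [v n, v n, u n] / S + \<rho> n ^ 2 * ?J n [u n, u n, v n] / 2
          + a n * s n ^ 3 * ?J n [v n, v n, v n, v n] / (6 * S) + a n * s n ^ 2 * \<rho> n * ?J n [v n, v n, v n, u n] / 2
          + \<xi> n / 6 * \<rho> n ^ 2 * (3 * s n * ?J n [v n, v n, u n, u n] + y n * ?J n [v n, u n, u n, u n])
          + a n ^ 2 / 24 * ?J n [?Q n, ?Q n, ?Q n, ?Q n, v n]"
      proof -
        have "s n * d n / \<xi> n / S\<^sup>2 = s n * d n / (\<xi> n * S\<^sup>2)" by simp
        moreover have "?J n [?Q n, ?Q n, v n] / 2 / S\<^sup>2 = s n ^ 2 * ?J n [v n, v n, v n] / (2 * S\<^sup>2)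
          + s n * \<rho> n * ?J n [v n, v n, u n] / S + \<rho> n ^ 2 * ?J n [u n, u n, v n] / 2"
          unfolding J3 S(3) using S(1) by (simp add: field_simps power2_eq_square)
        moreover have "\<xi> n / 6 * ?J n [?Q n, ?Q n, ?Q n, v n] / S\<^sup>2
          = a n * s n ^ 3 * ?J n [v n, v n, v n, v n] / (6 * S) + a n * s n ^ 2 * \<rho> n * ?J n [v n, v n, v n, u n] / 2
          + \<xi> n / 6 * \<rho> n ^ 2 * (3 * s n * ?J n [v n, v n, u n, u n] + y n * ?J n [v n, u n, u n, u n])"
        proof -
          define Z where "Z = 3 * s n * ?J n [v n, v n, u n, u n] + y n * ?J n [v n, u n, u n, u n]"
          show ?thesis
            unfolding J4 Z_def[symmetric] unfolding S(2,3) using S(1)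
            by (simp add: field_simps power2_eq_square power3_eq_cube)
        qed
        moreover have "\<xi> n ^ 2 / 24 * ?J n [?Q n, ?Q n, ?Q n, ?Q n, v n] / S\<^sup>2 = a n ^ 2 / 24 * ?J n [?Q n, ?Q n, ?Q n, ?Q n, v n]"
          unfolding S(2) using S(1) by (simp add: power_mult_distrib)
        ultimately show ?thesis unfolding add_divide_distrib by simp
      qed
      \<comment> \<open>This is the only term in which \<rho> meets a negative power of \<sigma>.
        Substituting for \<rho> yields the square in the numerator of \<open>C 3 n\<close>.\<close>
      also have "s n * \<rho> n * ?J n [v n, v n, u n] / S
          = s n * ?J n [v n, v n, u n] * \<omega> n - s n ^ 3 * (?J n [v n, v n, u n])\<^sup>2 / (2 * S)"
        unfolding \<rho>\<omega> using S(1) by (simp add: field_simps power2_eq_square power3_eq_cube)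
      finally have "a n ^ 2 * err r v n - ?T n = s n * d n / (\<xi> n * S\<^sup>2) + s n ^ 2 * ?J n [v n, v n, v n] / (2 * S\<^sup>2)
          - s n ^ 3 * (?J n [v n, v n, u n])\<^sup>2 / (2 * S) + a n * s n ^ 3 * ?J n [v n, v n, v n, v n] / (6 * S)"
        by simp
      also have "\<dots> = C 1 n * s n + C 2 n * s n ^ 2 + C 3 n * s n ^ 3"
        using S(1) by (simp add: C_def eval_nat_numeral S_def[symmetric] diff_divide_distrib algebra_simps)
      finally have "a n ^ 2 * err r v n - ?T n = C 1 n * s n + C 2 n * s n ^ 2 + C 3 n * s n ^ 3" .
      moreover have "(\<Sum>j\<le>4. C j n * s n ^ j) = C 0 n + C 1 n * s n + C 2 n * s n ^ 2 + C 3 n * s n ^ 3 + C 4 n * s n ^ 4"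
        by (simp add: eval_nat_numeral)
      moreover have "C 0 n = 0" "C 4 n = \<Gamma> / 24" by (simp_all add: C_def eval_nat_numeral)
      ultimately show ?case by simp
    qed
    have "((\<lambda>n. a n ^ 2 * err r v n - ?T n + \<Gamma> / 24 * s n ^ 4) \<longlongrightarrow> al ^ 2 * 0 -
      (l * b * \<omega>l + (- (l\<^sup>2 * b / 2)) ^ 2 * c / 2 + al * l ^ 2 * (- (l\<^sup>2 * b / 2)) * e / 2
      + 0 / 6 * (- (l\<^sup>2 * b / 2)) ^ 2 * (3 * l * jet_form h x [v', v', u', u'] + y' * jet_form h x [v', u', u', u'])
      + al ^ 2 / 24 * jet_form h x [?q, ?q, ?q, ?q, v']) + \<Gamma> / 24 * l ^ 4) F"
      by (intro tendsto_intros al \<xi> err_lim r s y \<rho>_lim \<omega>_lim J_lim Jv; simp)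
    moreover have "al ^ 2 * 0 -
      (l * b * \<omega>l + (- (l\<^sup>2 * b / 2)) ^ 2 * c / 2 + al * l ^ 2 * (- (l\<^sup>2 * b / 2)) * e / 2
      + 0 / 6 * (- (l\<^sup>2 * b / 2)) ^ 2 * (3 * l * jet_form h x [v', v', u', u'] + y' * jet_form h x [v', u', u', u'])
      + al ^ 2 / 24 * jet_form h x [?q, ?q, ?q, ?q, v']) + \<Gamma> / 24 * l ^ 4 = 0"
      unfolding q_eq jet_form_scaleR_front g_def[symmetric] \<Gamma>_def \<omega>l_def
      by (simp add: eval_nat_numeral field_simps)
    ultimately have "((\<lambda>n. \<Sum>j\<le>4. C j n * s n ^ j) \<longlongrightarrow> 0) F"
      using sum_eq by (simp add: tendsto_cong)
    then show "\<exists>s l. (s \<longlongrightarrow> l) F \<and> \<bar>l\<bar> = r \<and> ((\<lambda>n. \<Sum>j\<le>4. C j n * s n ^ j) \<longlongrightarrow> 0) F"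
      using s \<open>\<bar>l\<bar> = r\<close> by blast
  qed
  have nth: "C 1 n = d n / (\<xi> n * \<sigma> n ^ 2)" "C 2 n = ?J n [v n, v n, v n] / (2 * \<sigma> n ^ 2)"
    "C 3 n = (a n * ?J n [v n, v n, v n, v n] - 3 * (?J n [v n, v n, u n])\<^sup>2) / (6 * \<sigma> n)" "C 4 n = \<Gamma> / 24" for n
    by (simp_all add: C_def eval_nat_numeral)
  have "((\<lambda>n. C 1 n * (\<xi> n * \<sigma> n ^ 2)) \<longlongrightarrow> 0 * (0 * 0 ^ 2)) F"
    by (intro tendsto_mult tendsto_power C0 \<xi> \<sigma>0) simp
  moreover have "eventually (\<lambda>n. C 1 n * (\<xi> n * \<sigma> n ^ 2) = d n) F"
    using ev
  proof eventually_elim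
    case (elim n)
    then have "\<sigma> n \<noteq> 0" "\<xi> n \<noteq> 0" using \<xi>_pos[of n] by auto
    then show ?case unfolding nth by simp
  qed
  ultimately have "(d \<longlongrightarrow> 0) F" by (simp add: tendsto_cong)
  then show "jet_form h x [v', v'] = 0" by (rule tendsto_unique[OF F_nontrivial d_lim])
  have "((\<lambda>n. C 2 n * (2 * \<sigma> n ^ 2)) \<longlongrightarrow> 0 * (2 * 0 ^ 2)) F"
    by (intro tendsto_mult tendsto_power tendsto_const C0 \<sigma>0) simp
  moreover have "eventually (\<lambda>n. C 2 n * (2 * \<sigma> n ^ 2) = ?J n [v n, v n, v n]) F"
    unfolding nth using ev by eventually_elim simp
  ultimately have "((\<lambda>n. ?J n [v n, v n, v n]) \<longlongrightarrow> 0) F" by (simp add: tendsto_cong)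
  then show "jet_form h x [v', v', v'] = 0" by (rule tendsto_unique[OF F_nontrivial J_lim(1)])
  have "((\<lambda>n. C 3 n * (6 * \<sigma> n)) \<longlongrightarrow> 0 * (6 * 0)) F"
    by (intro tendsto_mult tendsto_const C0 \<sigma>0) simp
  moreover have "eventually (\<lambda>n. C 3 n * (6 * \<sigma> n) = a n * ?J n [v n, v n, v n, v n] - 3 * (?J n [v n, v n, u n])\<^sup>2) F"
    unfolding nth using ev by eventually_elim simp
  ultimately have "((\<lambda>n. a n * ?J n [v n, v n, v n, v n] - 3 * (?J n [v n, v n, u n])\<^sup>2) \<longlongrightarrow> 0) F"
    by (simp add: tendsto_cong)
  moreover have "((\<lambda>n. a n * ?J n [v n, v n, v n, v n] - 3 * (?J n [v n, v n, u n])\<^sup>2)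
      \<longlongrightarrow> al * jet_form h x [v', v', v', v'] - 3 * b\<^sup>2) F"
    by (intro tendsto_intros al J_lim)
  ultimately have "0 = al * jet_form h x [v', v', v', v'] - 3 * b\<^sup>2" by (rule tendsto_unique[OF F_nontrivial])
  then show "al * jet_form h x [v', v', v', v'] = 3 * b\<^sup>2" by simp
  have "C 4 = (\<lambda>n. \<Gamma> / 24)" by (rule ext) (rule nth)
  then have "\<Gamma> = 0" using C0[of 4] by (simp add: tendsto_const_iff F_nontrivial)
  then show "15 * b\<^sup>2 * c + g * al\<^sup>2 = 10 * e * b * al" by (simp add: \<Gamma>_def algebra_simps)
qed

end

subsection \<open>Steepness\<close>

text \<open>By \<open>nondeg\<close> the cubic form on the plane has no repeated zero direction. In
  a rotated frame \<open>p\<close>, \<open>w\<close> with \<open>p\<close> a zero, this supplies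
  both conditions of \<open>finite_critical_points_cubic\<close>, whereas \<open>sol\<close> gives a
  critical point for each of infinitely many radii.\<close>

lemma (in smooth_on_open) no_flat_cubic_plane:
  fixes u v :: "real^'n"
  assumes x: "x \<in> A" and frame: "norm u = 1" "norm v = 1" "u \<bullet> v = 0"
    and grad0: "jet_form h x [u] = 0" "jet_form h x [v] = 0"
    and hess0: "jet_form h x [u, u] = 0" "jet_form h x [v, v] = 0" "jet_form h x [u, v] = 0"
    and sol: "\<And>r. 0 \<le> r \<Longrightarrow> r \<le> 1 \<Longrightarrow> \<exists>s y. s\<^sup>2 + y\<^sup>2 = r\<^sup>2 \<and> (let q = s *\<^sub>R v + y *\<^sub>R u in
      \<delta> * s + jet_form h x [q, q, v] / 2 = 0 \<and> \<alpha> * y + jet_form h x [q, q, u] / 2 = 0)"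
    and nondeg: "\<And>p w. \<lbrakk>p \<noteq> 0; w \<noteq> 0; p \<bullet> w = 0; jet_form h x [p] = 0; jet_form h x [w] = 0;
      jet_form h x [p, p] = 0; jet_form h x [w, w] = 0; jet_form h x [w, p] = 0; jet_form h x [p, p, p] = 0\<rbrakk>
      \<Longrightarrow> jet_form h x [p, p, w] \<noteq> 0"
  shows False
proof -
  obtain \<theta> where \<theta>: "jet_form h x [cos \<theta> *\<^sub>R v + sin \<theta> *\<^sub>R u, cos \<theta> *\<^sub>R v + sin \<theta> *\<^sub>R u,
      cos \<theta> *\<^sub>R v + sin \<theta> *\<^sub>R u] = 0"
    using ex_zero_cubic_form[of v u x] unfolding Let_def by blast
  define C where "C = cos \<theta>"
  define S where "S = sin \<theta>"
  have CS: "C * C + S * S = 1" using sin_cos_squared_add[of \<theta>] by (simp add: C_def S_def power2_eq_square add.commute)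
  define p where "p = C *\<^sub>R v + S *\<^sub>R u"
  define w where "w = (- S) *\<^sub>R v + C *\<^sub>R u"
  let ?J = "jet_form h x"
  have uv: "u \<bullet> u = 1" "v \<bullet> v = 1" "v \<bullet> u = 0" using frame by (simp_all add: dot_square_norm inner_commute)
  have hess: "?J [k *\<^sub>R v + l *\<^sub>R u, k' *\<^sub>R v + l' *\<^sub>R u] = 0" for k l k' l'
    using hess0 jet_form_2_commute[OF x, of v u] by (simp add: jet_form_2_linear)
  have grad: "?J [k *\<^sub>R v + l *\<^sub>R u] = 0" for k l
    using grad0 by (simp add: jet_form_1 inner_add_right)
  have nd: "?J [k *\<^sub>R v + l *\<^sub>R u, k *\<^sub>R v + l *\<^sub>R u, (- l) *\<^sub>R v + k *\<^sub>R u] \<noteq> 0"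
    if "(k, l) \<noteq> (0, 0)" "?J [k *\<^sub>R v + l *\<^sub>R u, k *\<^sub>R v + l *\<^sub>R u, k *\<^sub>R v + l *\<^sub>R u] = 0" for k l
  proof (rule nondeg)
    have "(k *\<^sub>R v + l *\<^sub>R u) \<bullet> (k *\<^sub>R v + l *\<^sub>R u) = k\<^sup>2 + l\<^sup>2"
      "((- l) *\<^sub>R v + k *\<^sub>R u) \<bullet> ((- l) *\<^sub>R v + k *\<^sub>R u) = k\<^sup>2 + l\<^sup>2"
      by (simp_all add: inner_add_left inner_add_right inner_diff_left inner_diff_right uv frame(3) power2_eq_square)
    moreover have "k\<^sup>2 + l\<^sup>2 \<noteq> 0" using that(1) by (simp add: sum_power2_eq_zero_iff)
    ultimately show "k *\<^sub>R v + l *\<^sub>R u \<noteq> 0" "(- l) *\<^sub>R v + k *\<^sub>R u \<noteq> 0" by fastforce+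
    show "(k *\<^sub>R v + l *\<^sub>R u) \<bullet> ((- l) *\<^sub>R v + k *\<^sub>R u) = 0"
      by (simp add: inner_add_left inner_add_right inner_diff_left inner_diff_right uv frame(3))
  qed (rule hess grad that(2))+
  define b where "b = ?J [p, p, w]"
  define c where "c = ?J [w, w, p]"
  define k where "k = ?J [w, w, w]"
  have ppp: "?J [p, p, p] = 0" using \<theta> by (simp add: p_def C_def S_def)
  have "b \<noteq> 0"
    unfolding b_def p_def w_def
  proof (rule nd)
    show "(C, S) \<noteq> (0, 0)" using CS by auto
    show "?J [C *\<^sub>R v + S *\<^sub>R u, C *\<^sub>R v + S *\<^sub>R u, C *\<^sub>R v + S *\<^sub>R u] = 0" using ppp by (simp add: p_def)
  qed
  have exp_p: "?J [X *\<^sub>R p + Z *\<^sub>R w, X *\<^sub>R p + Z *\<^sub>R w, p] = 2 * X * Z * b + Z\<^sup>2 * c"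
    and exp_w: "?J [X *\<^sub>R p + Z *\<^sub>R w, X *\<^sub>R p + Z *\<^sub>R w, w] = X\<^sup>2 * b + 2 * X * Z * c + Z\<^sup>2 * k" for X Z
    using jet_form_3_expansion[OF x, of X p Z w] by (simp_all add: ppp b_def c_def k_def)
  \<comment> \<open>The linear factor belonging to \<open>p\<close> leaves a quadratic form with
    coefficients \<open>3 * b\<close>, \<open>3 * c\<close>, \<open>k\<close>. Zero discriminant
    would make \<open>q\<close> a double zero direction, where the derivatives along both
    \<open>p\<close> and \<open>w\<close> vanish.\<close>
  have disc: "4 * b * k \<noteq> 3 * c\<^sup>2"
  proof
    assume disc: "4 * b * k = 3 * c\<^sup>2"
    define q where "q = c *\<^sub>R p + (- 2 * b) *\<^sub>R w"
    have qp: "?J [q, q, p] = 0" unfolding q_def exp_p by (simp add: power2_eq_square)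
    have "?J [q, q, w] = b * (4 * b * k - 3 * c\<^sup>2)"
      unfolding q_def exp_w by (simp add: power2_eq_square algebra_simps)
    then have qw: "?J [q, q, w] = 0" using disc by simp
    define K where "K = c * C + 2 * b * S"
    define L where "L = c * S - 2 * b * C"
    have q: "q = K *\<^sub>R v + L *\<^sub>R u" by (simp add: q_def p_def w_def K_def L_def algebra_simps)
    have q': "(- L) *\<^sub>R v + K *\<^sub>R u = (2 * b) *\<^sub>R p + c *\<^sub>R w"
      by (simp add: p_def w_def K_def L_def algebra_simps)
    have "?J [q, q, q] = c * ?J [q, q, p] + (- 2 * b) * ?J [q, q, w]"
      by (subst (3) q_def) (simp only: jet_form_3_linear)
    then have "?J [q, q, q] = 0" using qp qw by simp
    moreover have "?J [q, q, (2 * b) *\<^sub>R p + c *\<^sub>R w] = 0" using qp qw by (simp add: jet_form_3_linear)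
    moreover have "K\<^sup>2 + L\<^sup>2 = (c\<^sup>2 + 4 * b\<^sup>2) * (C * C + S * S)"
      by (simp add: K_def L_def power2_eq_square algebra_simps)
    then have "(K, L) \<noteq> (0, 0)" using \<open>b \<noteq> 0\<close> by (auto simp: CS add_nonneg_eq_0_iff)
    ultimately show False using nd[of K L] unfolding q' q[symmetric] by blast
  qed
  \<comment> \<open>Entries in the frame \<open>p\<close>, \<open>w\<close> of the quadratic form
    that has diagonal entries \<delta>, \<alpha> in the frame \<open>v\<close>,
    \<open>u\<close>.\<close>
  define A11 where "A11 = \<delta> * C * C + \<alpha> * S * S"
  define A12 where "A12 = (\<alpha> - \<delta>) * S * C"
  define A22 where "A22 = \<delta> * S * S + \<alpha> * C * C"
  let ?Z = "{(X, Z). A11 * X + A12 * Z + b * X * Z + c * Z\<^sup>2 / 2 = 0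
    \<and> A12 * X + A22 * Z + b * X\<^sup>2 / 2 + c * X * Z + k * Z\<^sup>2 / 2 = 0}"
  have "{0..1} \<subseteq> (\<lambda>(X, Z). sqrt (X\<^sup>2 + Z\<^sup>2)) ` ?Z"
  proof
    fix r :: real assume r: "r \<in> {0..1}"
    then obtain s y where sy: "s\<^sup>2 + y\<^sup>2 = r\<^sup>2"
      and v0: "\<delta> * s + ?J [s *\<^sub>R v + y *\<^sub>R u, s *\<^sub>R v + y *\<^sub>R u, v] / 2 = 0"
      and u0: "\<alpha> * y + ?J [s *\<^sub>R v + y *\<^sub>R u, s *\<^sub>R v + y *\<^sub>R u, u] / 2 = 0"
      using sol[of r] unfolding Let_def by auto
    define X where "X = C * s + S * y"
    define Z where "Z = C * y - S * s"
    have s: "s = C * X - S * Z" and y: "y = S * X + C * Z"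
    proof -
      have "C * X - S * Z = (C * C + S * S) * s" "S * X + C * Z = (C * C + S * S) * y"
        by (simp_all add: X_def Z_def algebra_simps)
      then show "s = C * X - S * Z" "y = S * X + C * Z" by (simp_all add: CS)
    qed
    let ?q = "s *\<^sub>R v + y *\<^sub>R u"
    have q: "?q = X *\<^sub>R p + Z *\<^sub>R w" by (simp add: s y p_def w_def algebra_simps)
    have Jp: "?J [?q, ?q, p] = C * ?J [?q, ?q, v] + S * ?J [?q, ?q, u]"
      and Jw: "?J [?q, ?q, w] = - S * ?J [?q, ?q, v] + C * ?J [?q, ?q, u]"
      unfolding p_def w_def jet_form_3_linear(3,6) by simp_all
    have v1: "?J [?q, ?q, v] = - 2 * \<delta> * s" and u1: "?J [?q, ?q, u] = - 2 * \<alpha> * y"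
      using v0 u0 by simp_all
    have e1: "2 * X * Z * b + Z\<^sup>2 * c = - 2 * (C * \<delta> * s + S * \<alpha> * y)"
      using Jp unfolding v1 u1 unfolding q exp_p by simp
    have e2: "X\<^sup>2 * b + 2 * X * Z * c + Z\<^sup>2 * k = - 2 * (C * \<alpha> * y - S * \<delta> * s)"
      using Jw unfolding v1 u1 unfolding q exp_w by simp
    have "A11 * X + A12 * Z = C * \<delta> * s + S * \<alpha> * y" "A12 * X + A22 * Z = C * \<alpha> * y - S * \<delta> * s"
      unfolding s y A11_def A12_def A22_def by (simp_all add: algebra_simps)
    then have "(X, Z) \<in> ?Z" using e1 e2 by (simp add: algebra_simps)
    moreover have "sqrt (X\<^sup>2 + Z\<^sup>2) = r"
    proof -
      have "X\<^sup>2 + Z\<^sup>2 = (C * C + S * S) * (s\<^sup>2 + y\<^sup>2)"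
        by (simp add: X_def Z_def power2_eq_square algebra_simps)
      then show ?thesis using r by (simp add: CS sy)
    qed
    ultimately show "r \<in> (\<lambda>(X, Z). sqrt (X\<^sup>2 + Z\<^sup>2)) ` ?Z" by force
  qed
  moreover have "finite ?Z" using \<open>b \<noteq> 0\<close> disc by (rule finite_critical_points_cubic)
  ultimately have "finite {0..1::real}" by (rule finite_surj[rotated])
  then show False using infinite_Icc[of 0 "1::real"] by simp
qed

text \<open>In dimension four the relevant subspaces are lines, planes and hyperplanes, and
  hypotheses 1, 2 and 3 respectively exclude flat sequences on them.\<close>

theorem theorem5:
  fixes A :: "(real^4) set" and h :: "real^4 \<Rightarrow> real" and I :: "real^4"
  assumes "open A"
    and "smooth_fun_on A h"
    and "I \<in> A"
    and "grad h I \<noteq> 0"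
    and "five_jet_nondegenerate h I"
    and "\<And>v u. \<lbrakk>v \<noteq> 0;
          jet_form h I [v] = 0; jet_form h I [v, v] = 0; jet_form h I [v, v, v] = 0;
          jet_form h I [u] = 0; jet_form h I [u, v] = 0;
          jet_form h I [u, u] * jet_form h I [v, v, v, v] = 3 * (jet_form h I [v, v, u])^2;
          15 * (jet_form h I [v, v, u])^2 * jet_form h I [u, u, v]
            + jet_form h I [v, v, v, v, v] * (jet_form h I [u, u])^2
          = 10 * jet_form h I [v, v, v, u] * jet_form h I [u, v, v] * jet_form h I [u, u]\<rbrakk>
        \<Longrightarrow> rank (transpose (vector [u, v] :: real^4^2)) < 2"
    and "\<And>v u w. \<lbrakk>v \<noteq> 0;
          jet_form h I [v] = 0; jet_form h I [v, v] = 0; jet_form h I [v, v, v] = 0;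
          jet_form h I [u] = 0; jet_form h I [w] = 0;
          jet_form h I [u, v] = 0; jet_form h I [w, v] = 0\<rbrakk>
        \<Longrightarrow> rank (transpose (vector [u, v, w] :: real^4^3)) < 3"
  shows "\<exists>U. open U \<and> I \<in> U \<and> U \<subseteq> A \<and> steep_on A h U"
proof -
  interpret smooth_on_open A h using assms(1,2) by unfold_locales
  have no_line: False if "flat_sequence A h 1 I X V \<xi> \<epsilon> Q F" for X V \<xi> \<epsilon> Q F
  proof -
    interpret flat_sequence A h 1 I X V \<xi> \<epsilon> Q F by (rule that)
    show False using flat_direction assms(5) unfolding five_jet_nondegenerate_def by fastforce
  qed
  have no_plane: False if "flat_sequence A h 2 I X V \<xi> \<epsilon> Q F" for X V \<xi> \<epsilon> Q F
  proof -
    interpret fs: flat_sequence A h 2 I X V \<xi> \<epsilon> Q F by (rule that)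
    obtain u v u' v' where "flat_plane_sequence A h 2 I X V \<xi> \<epsilon> Q F u v u' v'"
      using fs.ex_flat_plane_sequence by blast
    then interpret flat_plane_sequence A h 2 I X V \<xi> \<epsilon> Q F u v u' v' .
    have nz: "u' \<noteq> 0" "v' \<noteq> 0" using limit_frame(1,2) by auto
    show False
    proof (cases "\<forall>M. eventually (\<lambda>n. M * \<xi> n < \<bar>a n\<bar>) F")
      case True
      then have ev: "eventually (\<lambda>n. M * \<xi> n < \<bar>a n\<bar>) F" for M by blast
      have "jet_form h I [u', v', v'] = jet_form h I [v', v', u']"
        by (rule jet_form_mset[OF assms(3)]) simp
      then have "rank (transpose (vector [u', v'] :: real^4^2)) < 2"
        using assms(6)[of v' u'] degenerate_case[OF ev] limit_frame nz by simp
      then show False using rank_transpose_vector_2_orthogonal[OF nz limit_frame(3)] by simp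
    next
      case False
      then obtain M where "\<not> eventually (\<lambda>n. M * \<xi> n < \<bar>a n\<bar>) F" by blast
      \<comment> \<open>The ultrafilter turns failure of an eventual lower bound into an eventual
        upper bound, so the two cases are exhaustive without passing to a subsequence.\<close>
      then have "eventually (\<lambda>n. \<not> M * \<xi> n < \<bar>a n\<bar>) F" using fs.F unfolding ultrafilter_def by blast
      then have "eventually (\<lambda>n. \<bar>a n\<bar> \<le> M * \<xi> n) F" by (simp add: not_less)
      note bd = bounded_case[OF this]
      from bd(3) obtain \<alpha> \<delta> where sol: "\<And>r. r \<in> {0..1} \<Longrightarrow> \<exists>s y. s\<^sup>2 + y\<^sup>2 = r\<^sup>2 \<and> (let q = s *\<^sub>R v' + y *\<^sub>R u' in
        \<delta> * s + jet_form h I [q, q, v'] / 2 = 0 \<and> \<alpha> * y + jet_form h I [q, q, u'] / 2 = 0)" by blast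
      show False
      proof (rule no_flat_cubic_plane[OF assms(3) limit_frame(1-5) bd(1,2) limit_frame(6)])
        show "\<exists>s y. s\<^sup>2 + y\<^sup>2 = r\<^sup>2 \<and> (let q = s *\<^sub>R v' + y *\<^sub>R u' in
          \<delta> * s + jet_form h I [q, q, v'] / 2 = 0 \<and> \<alpha> * y + jet_form h I [q, q, u'] / 2 = 0)"
          if "0 \<le> r" "r \<le> 1" for r using sol[of r] that by simp
        fix p w :: "real^4"
        assume pw: "p \<noteq> 0" "w \<noteq> 0" "p \<bullet> w = 0" "jet_form h I [p] = 0" "jet_form h I [w] = 0"
          "jet_form h I [p, p] = 0" "jet_form h I [w, w] = 0" "jet_form h I [w, p] = 0" "jet_form h I [p, p, p] = 0"
        show "jet_form h I [p, p, w] \<noteq> 0"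
        proof
          assume "jet_form h I [p, p, w] = 0"
          \<comment> \<open>Where the quadratic form vanishes on both vectors, the last two
            equations of hypothesis 2 only ask for
            \<open>jet_form h I [p, p, w] = 0\<close>.\<close>
          then have "rank (transpose (vector [w, p] :: real^4^2)) < 2"
            using assms(6)[of p w] pw by simp
          then show False
            using rank_transpose_vector_2_orthogonal[OF pw(2,1)] pw(3) by (simp add: inner_commute)
        qed
      qed
    qed
  qed
  have no_space: False if "flat_sequence A h 3 I X V \<xi> \<epsilon> Q F" for X V \<xi> \<epsilon> Q F
  proof -
    interpret flat_sequence A h 3 I X V \<xi> \<epsilon> Q F by (rule that)
    obtain v where v: "v \<noteq> 0" "jet_form h I [v] = 0" "jet_form h I [v, v, v] = 0"
      "\<And>w. jet_form h I [w] = 0 \<Longrightarrow> jet_form h I [v, w] = 0"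
      using flat_hyperplane assms(4) by auto
    \<comment> \<open>Fewer than four vectors leave a nonzero orthogonal vector. This completes
      \<open>v\<close> to three orthogonal vectors in the complement of the gradient, and the kernel
      property of \<open>v\<close> gives the remaining equations of hypothesis 3.\<close>
    have dim4: "dim S < DIM(real^4)" if "finite S" "card S < 4" for S :: "(real^4) set"
      using dim_le_card'[OF that(1)] that(2) by simp
    have "card {grad h I, v} < 4" by (simp add: card_insert_if)
    then obtain u where u: "u \<noteq> 0" "\<And>y. y \<in> span {grad h I, v} \<Longrightarrow> orthogonal u y"
      using orthogonal_to_subspace_exists[OF dim4, of "{grad h I, v}"] by auto
    have "card {grad h I, v, u} < 4" by (simp add: card_insert_if)
    then obtain w where w: "w \<noteq> 0" "\<And>y. y \<in> span {grad h I, v, u} \<Longrightarrow> orthogonal w y"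
      using orthogonal_to_subspace_exists[OF dim4, of "{grad h I, v, u}"] by auto
    have orth: "u \<bullet> grad h I = 0" "u \<bullet> v = 0" "w \<bullet> grad h I = 0" "w \<bullet> v = 0" "w \<bullet> u = 0"
      using u(2)[OF span_base] w(2)[OF span_base] by (auto simp: orthogonal_def)
    then have grad: "jet_form h I [u] = 0" "jet_form h I [w] = 0" by (simp_all add: jet_form_1 inner_commute)
    have hess: "jet_form h I [u, v] = 0" "jet_form h I [w, v] = 0"
      using v(4)[OF grad(1)] v(4)[OF grad(2)]
      by (simp_all add: jet_form_2_commute[OF assms(3), of u v] jet_form_2_commute[OF assms(3), of w v])
    have "rank (transpose (vector [u, v, w] :: real^4^3)) < 3"
      by (rule assms(7)[OF v(1,2) v(4)[OF v(2)] v(3) grad hess])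
    then show False
      using rank_transpose_vector_3_orthogonal[OF u(1) v(1) w(1) orth(2)] orth by (simp add: inner_commute)
  qed
  have "\<exists>r>0. \<exists>C>0. \<exists>\<delta>>0. \<forall>J\<in>ball I r. steep_ineq A h m C \<delta> 4 J" if "m \<in> {1..3}" for m
  proof (rule steep_nbhd_or_flat_sequence[OF assms(3)])
    show "1 \<le> m" using that by simp
    have "m = 1 \<or> m = 2 \<or> m = 3" using that by auto
    then show "\<not> flat_sequence A h m I X V \<xi> \<epsilon> Q F" for X V \<xi> \<epsilon> Q F
      using no_line no_plane no_space by blast
  qed
  then have "\<forall>m\<in>{1..3}. \<exists>r>0. \<exists>C>0. \<exists>\<delta>>0. \<forall>J\<in>ball I r. steep_ineq A h m C \<delta> 4 J" by blast
  from bchoice[OF this] obtain r where r: "\<forall>m\<in>{1..3::nat}. r m > 0 \<and>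
    (\<exists>C>0. \<exists>\<delta>>0. \<forall>J\<in>ball I (r m). steep_ineq A h m C \<delta> 4 J)" by blast
  obtain R where R: "R > 0" "ball I R \<subseteq> A" using assms(1,3) open_contains_ball by blast
  obtain R' where R': "R' > 0" "\<And>J. dist J I < R' \<Longrightarrow> grad h J \<noteq> 0"
    using continuous_at_avoid[OF isCont_grad[OF assms(3)] assms(4)] by (metis dist_commute)
  \<comment> \<open>One ball that lies in \<open>A\<close>, keeps the gradient nonzero, and lies in
    the neighbourhoods found for the three dimensions.\<close>
  define U where "U = ball I (Min {R, R', r 1, r 2, r 3})"
  have "Min {R, R', r 1, r 2, r 3} > 0" using R(1) R'(1) r by simp
  then have "open U" "I \<in> U" by (simp_all add: U_def)
  moreover have "U \<subseteq> A" using R(2) by (auto simp: U_def)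
  moreover have "steep_on A h U"
    unfolding steep_on_def
  proof (intro conjI ballI)
    show "grad h J \<noteq> 0" if "J \<in> U" for J using that R'(2)[of J] by (simp add: U_def dist_commute)
    fix m assume "m \<in> {1..CARD(4) - 1}"
    then have m: "m \<in> {1..3}" by simp
    then obtain C \<delta> where "C > 0" "\<delta> > 0" "\<forall>J\<in>ball I (r m). steep_ineq A h m C \<delta> 4 J" using r by blast
    moreover have "m = 1 \<or> m = 2 \<or> m = 3" using m by auto
    then have "U \<subseteq> ball I (r m)" by (auto simp: U_def)
    ultimately show "\<exists>C \<delta> \<alpha>. 0 < C \<and> 0 < \<delta> \<and> 1 < \<alpha> \<and> (\<forall>I\<in>U. steep_ineq A h m C \<delta> \<alpha> I)"
      by (intro exI[of _ C] exI[of _ \<delta>] exI[of _ 4]) auto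
  qed fact
  ultimately show ?thesis by blast
qed

end
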